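(* Let $\Gamma$ be a nonelementary word-hyperbolic group, $S$ a finite generating set of $\Gamma$, and $\mathfrak K$ the conjugacy class of an element in $\Gamma-Z^{\rm virt}(\Gamma)$. Then $$\limsup_{n\to+\infty}\frac1n\ln N_{\mathfrak K,S}(n)=\frac12\limsup_{n\to+\infty}\frac1n\ln\operatorname{Card}B_{d_S}(e,n).$$
   Context: For $\gamma\in\Gamma$, $\|\gamma\|$ is the smallest length of a word in $S\cup S^{-1}$ representing $\gamma$; $d_S(\gamma,\gamma')=\|\gamma^{-1}\gamma'\|$ is the word metric, $B_{d_S}(e,n)$ is the ball of radius $n$ centred at the identity $e$, and $N_{\mathfrak K,S}(n)=\operatorname{Card}(\mathfrak K\cap B_{d_S}(e,n))$. The virtual center $Z^{\rm virt}(\Gamma)$ of a nonelementary word-hyperbolic group $\Gamma$ is the finite subgroup of elements acting by the identity on the boundary at infinity $\partial_\infty\Gamma$; equivalently, of elements having finitely many conjugates in $\Gamma$; equivalently, of elements whose centraliser in $\Gamma$ has finite index. *)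

theory Defs
  imports
    "HOL-Algebra.Coset"
    "HOL-Algebra.Generated_Groups"
    "HOL-Analysis.Abstract_Metric_Spaces"
    "HOL-Library.Extended_Real"
begin

definition finite_generating_set :: "('a, 'b) monoid_scheme \<Rightarrow> 'a set \<Rightarrow> bool" where
  "finite_generating_set G S \<longleftrightarrow>
     finite S \<and> S \<subseteq> carrier G \<and> generate G S = carrier G"

definition represents :: "('a, 'b) monoid_scheme \<Rightarrow> 'a set \<Rightarrow> 'a list \<Rightarrow> 'a \<Rightarrow> bool" where
  "represents G S w g \<longleftrightarrow>
     set w \<subseteq> S \<union> (\<lambda>s. inv\<^bsub>G\<^esub> s) ` S \<and> foldr (mult G) w \<one>\<^bsub>G\<^esub> = g"

definition word_norm :: "('a, 'b) monoid_scheme \<Rightarrow> 'a set \<Rightarrow> 'a \<Rightarrow> nat" where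
  "word_norm G S g = (LEAST n. \<exists>w. represents G S w g \<and> length w = n)"

text \<open>The value 0 off the carrier is chosen because \<^locale>\<open>Metric_space\<close> demands symmetry everywhere.\<close>

definition word_dist :: "('a, 'b) monoid_scheme \<Rightarrow> 'a set \<Rightarrow> 'a \<Rightarrow> 'a \<Rightarrow> real" where
  "word_dist G S g h =
     (if g \<in> carrier G \<and> h \<in> carrier G
      then real (word_norm G S (inv\<^bsub>G\<^esub> g \<otimes>\<^bsub>G\<^esub> h)) else 0)"

definition word_ball :: "('a, 'b) monoid_scheme \<Rightarrow> 'a set \<Rightarrow> nat \<Rightarrow> 'a set" where
  "word_ball G S n = Metric_space.mcball (carrier G) (word_dist G S) \<one>\<^bsub>G\<^esub> (real n)"

text \<open>
  The word metric is a metric on the carrier with finite balls, so that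
  \<^const>\<open>Metric_space.mcball\<close> and \<^const>\<open>card\<close> have their intended meaning below.
\<close>

context group
begin

lemma foldr_mult_closed:
  "set w \<subseteq> carrier G \<Longrightarrow> foldr (\<otimes>) w \<one> \<in> carrier G"
  by (induction w) auto

lemma foldr_mult_append:
  "set v \<subseteq> carrier G \<Longrightarrow> set w \<subseteq> carrier G \<Longrightarrow>
     foldr (\<otimes>) (v @ w) \<one> = foldr (\<otimes>) v \<one> \<otimes> foldr (\<otimes>) w \<one>"
proof (induction v)
  case Nil
  then show ?case using foldr_mult_closed by simp
next
  case (Cons a v)
  then show ?case using foldr_mult_closed by (simp add: m_assoc)
qed

lemma represents_set:
  assumes "S \<subseteq> carrier G" "represents G S w g"
  shows "set w \<subseteq> carrier G" "g \<in> carrier G"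
proof -
  show 1: "set w \<subseteq> carrier G"
    using assms unfolding represents_def by auto
  show "g \<in> carrier G"
    using assms(2) foldr_mult_closed[OF 1] unfolding represents_def by simp
qed

lemma represents_append:
  assumes "S \<subseteq> carrier G" "represents G S v g" "represents G S w h"
  shows "represents G S (v @ w) (g \<otimes> h)"
  using assms foldr_mult_append represents_set(1)[OF assms(1)]
  unfolding represents_def by (metis Un_least set_append)

lemma represents_inverse:
  assumes "S \<subseteq> carrier G" "represents G S w g"
  shows "\<exists>v. represents G S v (inv g) \<and> length v = length w"
  using assms(2)
proof (induction w arbitrary: g)
  case Nil
  then show ?case by (auto simp: represents_def)
next
  case (Cons a w)
  let ?h = "foldr (\<otimes>) w \<one>"
  have h: "represents G S w ?h" and g: "g = a \<otimes> ?h"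
    and a: "a \<in> S \<union> (\<lambda>s. inv s) ` S"
    using Cons.prems by (auto simp: represents_def)
  obtain v where v: "represents G S v (inv ?h)" "length v = length w"
    using Cons.IH[OF h] by blast
  have aG: "a \<in> carrier G" using a assms(1) by auto
  have "inv a \<in> S \<union> (\<lambda>s. inv s) ` S"
    using a assms(1) by (auto simp: subset_iff)
  then have "represents G S [inv a] (inv a)"
    using aG by (simp add: represents_def)
  from represents_append[OF assms(1) v(1) this]
  have "represents G S (v @ [inv a]) (inv g)"
    using g aG represents_set(2)[OF assms(1) h] by (simp add: inv_mult_group)
  then show ?case using v(2) by (intro exI[of _ "v @ [inv a]"]) simp
qed

lemma represents_exists:
  assumes "finite_generating_set G S" "g \<in> carrier G"
  shows "\<exists>w. represents G S w g"
proof -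
  have SG: "S \<subseteq> carrier G" and "g \<in> generate G S"
    using assms by (auto simp: finite_generating_set_def)
  from this(2) show ?thesis
  proof induction
    case one
    show ?case by (rule exI[of _ "[]"]) (simp add: represents_def)
  next
    case (incl h)
    then show ?case using SG
      by (intro exI[of _ "[h]"]) (auto simp: represents_def subset_iff)
  next
    case (inv h)
    then show ?case using SG
      by (intro exI[of _ "[inv h]"]) (auto simp: represents_def subset_iff)
  next
    case (eng h1 h2)
    then show ?case using represents_append[OF SG] by blast
  qed
qed

lemma word_norm_attained:
  assumes "finite_generating_set G S" "g \<in> carrier G"
  obtains w where "represents G S w g" "length w = word_norm G S g"
proof -
  have "\<exists>n w. represents G S w g \<and> length w = n"
    using represents_exists[OF assms] by blast
  from LeastI_ex[OF this] show ?thesis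
    using that unfolding word_norm_def by blast
qed

lemma word_norm_le: "represents G S w g \<Longrightarrow> word_norm G S g \<le> length w"
  unfolding word_norm_def by (rule Least_le) blast

lemma word_norm_inv_le:
  assumes "finite_generating_set G S" "g \<in> carrier G"
  shows "word_norm G S (inv g) \<le> word_norm G S g"
proof -
  have SG: "S \<subseteq> carrier G" using assms(1) by (simp add: finite_generating_set_def)
  obtain w where w: "represents G S w g" "length w = word_norm G S g"
    using word_norm_attained[OF assms] .
  obtain v where "represents G S v (inv g)" "length v = length w"
    using represents_inverse[OF SG w(1)] by blast
  then show ?thesis using word_norm_le w(2) by metis
qed

lemma word_norm_mult_le:
  assumes "finite_generating_set G S" "g \<in> carrier G" "h \<in> carrier G"
  shows "word_norm G S (g \<otimes> h) \<le> word_norm G S g + word_norm G S h"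
proof -
  have SG: "S \<subseteq> carrier G" using assms(1) by (simp add: finite_generating_set_def)
  obtain v where v: "represents G S v g" "length v = word_norm G S g"
    using word_norm_attained[OF assms(1,2)] .
  obtain w where w: "represents G S w h" "length w = word_norm G S h"
    using word_norm_attained[OF assms(1,3)] .
  show ?thesis
    using word_norm_le[OF represents_append[OF SG v(1) w(1)]] v(2) w(2) by simp
qed

lemma word_norm_eq_0_iff:
  assumes "finite_generating_set G S" "g \<in> carrier G"
  shows "word_norm G S g = 0 \<longleftrightarrow> g = \<one>"
proof
  assume "word_norm G S g = 0"
  moreover obtain w where "represents G S w g" "length w = word_norm G S g"
    using word_norm_attained[OF assms] .
  ultimately show "g = \<one>" by (simp add: represents_def)
next
  assume "g = \<one>"
  then have "represents G S [] g" by (simp add: represents_def)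
  from word_norm_le[OF this] show "word_norm G S g = 0" by simp
qed

lemma Metric_space_word_dist:
  assumes S: "finite_generating_set G S"
  shows "Metric_space (carrier G) (word_dist G S)"
proof
  fix x y z
  show "0 \<le> word_dist G S x y" by (simp add: word_dist_def)
  have le: "word_dist G S a b \<le> word_dist G S b a"
    if "a \<in> carrier G" "b \<in> carrier G" for a b
    using word_norm_inv_le[OF S, of "inv b \<otimes> a"] that
    by (simp add: word_dist_def inv_mult_group)
  show "word_dist G S x y = word_dist G S y x"
  proof (cases "x \<in> carrier G \<and> y \<in> carrier G")
    case True
    then show ?thesis using le[of x y] le[of y x] by simp
  qed (auto simp: word_dist_def)
  show "word_dist G S x y = 0 \<longleftrightarrow> x = y" if "x \<in> carrier G" "y \<in> carrier G"
  proof -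
    have "inv x \<otimes> y = \<one> \<longleftrightarrow> x = y"
      using that by (metis inv_closed inv_equality inv_inv l_inv)
    then show ?thesis
      using that word_norm_eq_0_iff[OF S, of "inv x \<otimes> y"] by (simp add: word_dist_def)
  qed
  show "word_dist G S x z \<le> word_dist G S x y + word_dist G S y z"
    if xyz: "x \<in> carrier G" "y \<in> carrier G" "z \<in> carrier G"
  proof -
    have "(inv x \<otimes> y) \<otimes> (inv y \<otimes> z) = inv x \<otimes> z"
      using xyz by (metis inv_closed l_one m_assoc m_closed r_inv)
    then show ?thesis
      using word_norm_mult_le[OF S, of "inv x \<otimes> y" "inv y \<otimes> z"] xyz
      by (simp add: word_dist_def)
  qed
qed

lemma finite_word_ball:
  assumes S: "finite_generating_set G S"
  shows "finite (word_ball G S n)"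
proof -
  interpret W: Metric_space "carrier G" "word_dist G S"
    by (rule Metric_space_word_dist[OF S])
  let ?W = "{w. set w \<subseteq> S \<union> (\<lambda>s. inv s) ` S \<and> length w \<le> n}"
  have "finite ?W"
    using S by (intro finite_lists_length_le) (simp add: finite_generating_set_def)
  moreover have "word_ball G S n \<subseteq> (\<lambda>w. foldr (\<otimes>) w \<one>) ` ?W"
  proof
    fix g assume "g \<in> word_ball G S n"
    then have g: "g \<in> carrier G" "word_norm G S g \<le> n"
      by (auto simp: word_ball_def word_dist_def)
    obtain w where "represents G S w g" "length w = word_norm G S g"
      using word_norm_attained[OF S g(1)] .
    with g(2) show "g \<in> (\<lambda>w. foldr (\<otimes>) w \<one>) ` ?W"
      by (auto simp: represents_def)
  qed
  ultimately show ?thesis by (rule finite_surj)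
qed

end

definition gromov_product :: "('a \<Rightarrow> 'a \<Rightarrow> real) \<Rightarrow> 'a \<Rightarrow> 'a \<Rightarrow> 'a \<Rightarrow> real" where
  "gromov_product d p x y = (d x p + d y p - d x y) / 2"

definition gromov_hyperbolic :: "'a set \<Rightarrow> ('a \<Rightarrow> 'a \<Rightarrow> real) \<Rightarrow> bool" where
  "gromov_hyperbolic M d \<longleftrightarrow>
     (\<exists>\<delta>\<ge>0. \<forall>p\<in>M. \<forall>x\<in>M. \<forall>y\<in>M. \<forall>z\<in>M.
        gromov_product d p x z \<ge> min (gromov_product d p x y) (gromov_product d p y z) - \<delta>)"

definition word_hyperbolic :: "('a, 'b) monoid_scheme \<Rightarrow> bool" where
  "word_hyperbolic G \<longleftrightarrow>
     (\<exists>S. finite_generating_set G S \<and> gromov_hyperbolic (carrier G) (word_dist G S))"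

text \<open>
  A group is elementary if it is finite or virtually infinite cyclic. Finite groups are included
  since \<open>a\<close> may be the identity or any other element of finite order.
\<close>

definition elementary :: "('a, 'b) monoid_scheme \<Rightarrow> bool" where
  "elementary G \<longleftrightarrow> (\<exists>a\<in>carrier G. finite (rcosets\<^bsub>G\<^esub> (generate G {a})))"

text \<open>
  Points at infinity are classes of sequences \<open>u\<close> with \<open>(u i | u j)\<^sub>p \<rightarrow> \<infinity>\<close> as \<open>i, j \<rightarrow> \<infinity>\<close>, where
  \<open>u\<close> and \<open>v\<close> are identified if \<open>(u i | v j)\<^sub>p \<rightarrow> \<infinity>\<close>.
\<close>

definition asymptotic :: "('a \<Rightarrow> 'a \<Rightarrow> real) \<Rightarrow> 'a \<Rightarrow> (nat \<Rightarrow> 'a) \<Rightarrow> (nat \<Rightarrow> 'a) \<Rightarrow> bool" where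
  "asymptotic d p u v \<longleftrightarrow>
     filterlim (\<lambda>(i, j). gromov_product d p (u i) (v j)) at_top (sequentially \<times>\<^sub>F sequentially)"

definition sequences_to_infinity ::
    "'a set \<Rightarrow> ('a \<Rightarrow> 'a \<Rightarrow> real) \<Rightarrow> 'a \<Rightarrow> (nat \<Rightarrow> 'a) set" where
  "sequences_to_infinity M d p = {u. range u \<subseteq> M \<and> asymptotic d p u u}"

definition asymptotic_rel ::
    "'a set \<Rightarrow> ('a \<Rightarrow> 'a \<Rightarrow> real) \<Rightarrow> 'a \<Rightarrow> ((nat \<Rightarrow> 'a) \<times> (nat \<Rightarrow> 'a)) set" where
  "asymptotic_rel M d p =
     {(u, v). u \<in> sequences_to_infinity M d p \<and> v \<in> sequences_to_infinity M d p \<and>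
              asymptotic d p u v}"

definition gromov_boundary ::
    "'a set \<Rightarrow> ('a \<Rightarrow> 'a \<Rightarrow> real) \<Rightarrow> 'a \<Rightarrow> (nat \<Rightarrow> 'a) set set" where
  "gromov_boundary M d p = sequences_to_infinity M d p // asymptotic_rel M d p"

definition group_boundary :: "('a, 'b) monoid_scheme \<Rightarrow> 'a set \<Rightarrow> (nat \<Rightarrow> 'a) set set" where
  "group_boundary G S = gromov_boundary (carrier G) (word_dist G S) \<one>\<^bsub>G\<^esub>"

text \<open>Saturating under the equivalence relation turns the left translate of a class into a class.\<close>

definition boundary_action ::
    "('a, 'b) monoid_scheme \<Rightarrow> 'a set \<Rightarrow> 'a \<Rightarrow> (nat \<Rightarrow> 'a) set \<Rightarrow> (nat \<Rightarrow> 'a) set" where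
  "boundary_action G S g \<xi> =
     asymptotic_rel (carrier G) (word_dist G S) \<one>\<^bsub>G\<^esub> `` ((\<lambda>u n. g \<otimes>\<^bsub>G\<^esub> u n) ` \<xi>)"

text \<open>
  For a word-hyperbolic group the boundary, and hence the following subgroup, does not depend on
  the finite generating set \<open>S\<close>.
\<close>

definition virtual_center :: "('a, 'b) monoid_scheme \<Rightarrow> 'a set \<Rightarrow> 'a set" where
  "virtual_center G S =
     {g \<in> carrier G. \<forall>\<xi>\<in>group_boundary G S. boundary_action G S g \<xi> = \<xi>}"

definition conjugacy_class :: "('a, 'b) monoid_scheme \<Rightarrow> 'a \<Rightarrow> 'a set" where
  "conjugacy_class G k = {g \<otimes>\<^bsub>G\<^esub> k \<otimes>\<^bsub>G\<^esub> inv\<^bsub>G\<^esub> g | g. g \<in> carrier G}"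

definition conj_count :: "('a, 'b) monoid_scheme \<Rightarrow> 'a set \<Rightarrow> 'a set \<Rightarrow> nat \<Rightarrow> nat" where
  "conj_count G K S n = card (K \<inter> word_ball G S n)"

text \<open>
  The upper limit of \<open>ln (f n) / n\<close>, taken in the extended reals. The convention \<open>ln 0 = 0\<close> is
  harmless for functions \<open>f\<close> that are eventually positive.
\<close>

definition exp_growth_rate :: "(nat \<Rightarrow> nat) \<Rightarrow> ereal" where
  "exp_growth_rate f = limsup (\<lambda>n. ereal (1 / real n * ln (real (f n))))"

end

theory Submission
  imports Defs "HOL-Real_Asymp.Real_Asymp" "HOL-Analysis.Extended_Real_Limits"
begin

text \<open>
  The theorem says that conjugates of \<open>k\<close> look like \<open>g \<otimes> k \<otimes> inv g\<close> with hardly any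
  cancellation: the path from \<open>\<one>\<close> out to \<open>g\<close> and back by another way has length \<open>2 * \<ell> g\<close> up to
  a constant, so conjugates of length at most \<open>n\<close> correspond to elements \<open>g\<close> of length at most
  \<open>n / 2\<close>.

  Upper bound. For a given conjugate choose \<open>h\<close> of least length with \<open>x = inv h \<otimes> k \<otimes> h\<close>. If \<open>x\<close>
  were much shorter than \<open>2 * \<ell> h\<close>, the geodesic from \<open>\<one>\<close> to \<open>h\<close> and its translate by \<open>k\<close> would
  run side by side for a long time, a pigeonhole argument would produce a repetition, and cutting it
  out would shorten \<open>h\<close> (\<open>shortest_conjugator\<close>, \<open>conj_count_le_ball\<close>).

  Lower bound. Conjugation of \<open>k\<close> itself can be far from injective, so \<open>k\<close> is first replaced by a
  conjugate \<open>x\<close> of bounded length, depending on \<open>g\<close>, for which \<open>g \<otimes> x \<otimes> inv g\<close> has no substantial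
  cancellation. Then \<open>g\<close> lies near a geodesic from \<open>\<one>\<close> to \<open>g \<otimes> x \<otimes> inv g\<close> and is recovered from
  this conjugate up to linearly many choices (\<open>ball_le_conj_count\<close>). That such an \<open>x\<close> exists
  (\<open>conjugate_moves_away\<close>) is the main point. If it did not, a compactness argument would give a
  geodesic ray whose end is fixed by all conjugates of \<open>k\<close>. The stabilizer of the end of a ray acts
  on the ray by coarse translations with finite fibres, so it is virtually cyclic; conjugation
  permutes an infinite conjugacy class inside it, and this makes the whole group elementary
  (\<open>elementary_if_invariant_set_stabilizes_ray\<close>).

  The conjugacy class is infinite because an element with finitely many conjugates moves points by
  a bounded amount and so acts trivially on the boundary
  (\<open>finite_conjugacy_class_virtual_center\<close>). Finally, hyperbolicity is given for some generating set,
  whereas lengths are counted in \<open>S\<close>; it is carried over to \<open>S\<close> by a weak form of the stability of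
  quasigeodesics (\<open>geodesic_near_quasigeodesic\<close>, \<open>gromov_hyperbolic_bilipschitz\<close>).
\<close>

section \<open>Hyperbolic discrete geodesic spaces\<close>

context Metric_space
begin

abbreviation gp :: "'a \<Rightarrow> 'a \<Rightarrow> 'a \<Rightarrow> real" where
  "gp \<equiv> gromov_product d"

lemma gp_commute: "gp p x y = gp p y x"
  by (simp add: gromov_product_def commute add.commute)

lemma gp_same: "x \<in> M \<Longrightarrow> gp p x x = d x p"
  by (simp add: gromov_product_def mdist_zero)

lemma gp_le_dist: "p \<in> M \<Longrightarrow> x \<in> M \<Longrightarrow> y \<in> M \<Longrightarrow> gp p x y \<le> d x p"
  using triangle[of y x p] by (simp add: gromov_product_def commute)

lemma gp_nonneg: "p \<in> M \<Longrightarrow> x \<in> M \<Longrightarrow> y \<in> M \<Longrightarrow> 0 \<le> gp p x y"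
  using triangle[of x p y] by (simp add: gromov_product_def commute)

lemma gp_change_base:
  "p \<in> M \<Longrightarrow> q \<in> M \<Longrightarrow> x \<in> M \<Longrightarrow> y \<in> M \<Longrightarrow> gp p x y \<le> gp q x y + d p q"
  using triangle[of x q p] triangle[of y q p]
  by (simp add: gromov_product_def commute field_simps)

lemma gp_change_point:
  "p \<in> M \<Longrightarrow> x \<in> M \<Longrightarrow> x' \<in> M \<Longrightarrow> y \<in> M \<Longrightarrow> gp p x y \<le> gp p x' y + d x x'"
  using triangle[of x x' p] triangle[of x' x y]
  by (simp add: gromov_product_def commute field_simps)

end

text \<open>
  Integer-valued metrics in which every pair of points is joined by a discrete geodesic: the
  metric abstraction of a word metric, seen as the vertex set of a Cayley graph.
\<close>

locale discrete_geodesic_space = Metric_space +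
  assumes geodesic_point:
    "x \<in> M \<Longrightarrow> y \<in> M \<Longrightarrow> real n \<le> d x y \<Longrightarrow> \<exists>c\<in>M. d x c = real n \<and> d c y = d x y - real n"
  and dist_Nats: "x \<in> M \<Longrightarrow> y \<in> M \<Longrightarrow> d x y \<in> \<nat>"

locale hyperbolic_geodesic_space = discrete_geodesic_space +
  fixes \<delta> :: real
  assumes delta_nonneg: "0 \<le> \<delta>"
  and four_point:
    "p \<in> M \<Longrightarrow> x \<in> M \<Longrightarrow> y \<in> M \<Longrightarrow> z \<in> M \<Longrightarrow>
       min (gp p x y) (gp p y z) - \<delta> \<le> gp p x z"

lemma (in discrete_geodesic_space) geodesic_path:
  assumes "x \<in> M" "y \<in> M"
  obtains q n where "q 0 = x" "q n = y" "\<forall>i\<le>n. q i \<in> M" "d x y = real n"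
    "\<forall>i\<le>n. \<forall>j\<le>n. d (q i) (q j) = \<bar>real i - real j\<bar>"
proof -
  have "\<exists>q. q 0 = x \<and> q n = y \<and> (\<forall>i\<le>n. q i \<in> M) \<and>
            (\<forall>i j. i \<le> j \<longrightarrow> j \<le> n \<longrightarrow> d (q i) (q j) = real j - real i)"
    if "x \<in> M" "y \<in> M" "d x y = real n" for x y n
    using that
  proof (induction n arbitrary: y)
    case 0
    then have "x = y" by simp
    then show ?case using 0 by (intro exI[of _ "\<lambda>_. x"]) auto
  next
    case (Suc n)
    obtain c where c: "c \<in> M" "d x c = real n" "d c y = 1"
      using geodesic_point[OF Suc.prems(1,2), of n] Suc.prems(3) by auto
    obtain q where q: "q 0 = x" "q n = c" "\<And>i. i \<le> n \<Longrightarrow> q i \<in> M"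
      "\<And>i j. i \<le> j \<Longrightarrow> j \<le> n \<Longrightarrow> d (q i) (q j) = real j - real i"
      using Suc.IH[OF Suc.prems(1) c(1,2)] by blast
    have last: "d (q i) y = real (Suc n) - real i" if "i \<le> n" for i
    proof -
      have "d (q i) y \<le> d (q i) c + d c y" "d x y \<le> d x (q i) + d (q i) y"
        using triangle q(3)[OF that] Suc.prems(1,2) c(1) by auto
      moreover have "d x (q i) = real i" "d (q i) c = real n - real i"
        using q(1,2) q(4)[of 0 i] q(4)[of i n] that by auto
      ultimately show ?thesis using c(3) Suc.prems(3) by simp
    qed
    show ?case
    proof (intro exI[of _ "q(Suc n := y)"] conjI allI impI)
      fix i j assume "i \<le> j" "j \<le> Suc n"
      then show "d ((q(Suc n := y)) i) ((q(Suc n := y)) j) = real j - real i"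
        using q(4)[of i j] last[of i] Suc.prems(2)
        by (cases "j = Suc n"; cases "i = Suc n") auto
    qed (use q Suc.prems in auto)
  qed
  moreover obtain n where "d x y = real n"
    using dist_Nats[OF assms] by (auto elim: Nats_cases)
  ultimately obtain q where q: "q 0 = x" "q n = y" "\<And>i. i \<le> n \<Longrightarrow> q i \<in> M" "d x y = real n"
    "\<And>i j. i \<le> j \<Longrightarrow> j \<le> n \<Longrightarrow> d (q i) (q j) = real j - real i"
    using assms by blast
  have "d (q i) (q j) = \<bar>real i - real j\<bar>" if "i \<le> n" "j \<le> n" for i j
    using q(5)[of i j] q(5)[of j i] commute[of "q i" "q j"] that by (cases "i \<le> j") auto
  then show ?thesis using that q(1-4) by blast
qed

context hyperbolic_geodesic_space
begin

text \<open>
  The four-point condition used along a balanced binary tree of splittings: joining \<open>2 ^ k\<close> steps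
  costs only \<open>k * \<delta>\<close>. This logarithmic loss expresses the exponential divergence of
  geodesics: a path that avoids a large ball around \<open>p\<close> must be exponentially long.
\<close>

lemma gp_chain:
  assumes "p \<in> M" "1 \<le> N" "N \<le> 2 ^ k"
    and "\<And>i. i \<le> N \<Longrightarrow> f i \<in> M"
    and "\<And>i. i < N \<Longrightarrow> m \<le> gp p (f i) (f (Suc i))"
  shows "m - real k * \<delta> \<le> gp p (f 0) (f N)"
  using assms(2-)
proof (induction k arbitrary: f N)
  case 0
  then have "N = 1" by simp
  then show ?case using "0.prems"(4)[of 0] by simp
next
  case (Suc k)
  show ?case
  proof (cases "N \<le> 2 ^ k")
    case True
    have "m - real k * \<delta> \<le> gp p (f 0) (f N)"
      by (rule Suc.IH) (use True Suc.prems in auto)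
    then show ?thesis using delta_nonneg by (simp add: algebra_simps)
  next
    case False
    define n where "n = (2::nat) ^ k"
    have n: "1 \<le> n" "n < N" "N - n \<le> 2 ^ k"
      using False Suc.prems(2) by (auto simp: n_def)
    have "m - real k * \<delta> \<le> gp p (f 0) (f n)"
      by (rule Suc.IH) (use n Suc.prems in \<open>auto simp: n_def\<close>)
    moreover have "m - real k * \<delta> \<le> gp p (f (n + 0)) (f (n + (N - n)))"
      by (rule Suc.IH) (use n Suc.prems in auto)
    moreover have "min (gp p (f 0) (f n)) (gp p (f n) (f N)) - \<delta> \<le> gp p (f 0) (f N)"
      using four_point assms(1) Suc.prems(3) n by auto
    ultimately show ?thesis using n by (simp add: algebra_simps)
  qed
qed

lemma gp_chain_between:
  assumes "p \<in> M" "\<And>i. i \<le> n \<Longrightarrow> q i \<in> M"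
    and m: "\<And>i. i < n \<Longrightarrow> m \<le> gp p (q i) (q (Suc i))" "\<And>i. i \<le> n \<Longrightarrow> m \<le> d (q i) p"
    and "i \<le> n" "j \<le> n" "\<bar>real i - real j\<bar> \<le> 2 ^ k"
  shows "m - real k * \<delta> \<le> gp p (q i) (q j)"
proof -
  have *: "m - real k * \<delta> \<le> gp p (q i) (q j)"
    if "i \<le> j" "j \<le> n" "\<bar>real i - real j\<bar> \<le> 2 ^ k" for i j
  proof (cases "i = j")
    case True
    have "0 \<le> real k * \<delta>" using delta_nonneg by simp
    then show ?thesis using True m(2)[of j] that assms(2)[of j] by (simp add: gp_same)
  next
    case False
    have "real (j - i) \<le> 2 ^ k" using that by (simp add: of_nat_diff)
    then have "j - i \<le> 2 ^ k" by (metis of_nat_le_iff of_nat_numeral of_nat_power)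
    then have "m - real k * \<delta> \<le> gp p (q (i + 0)) (q (i + (j - i)))"
      using False that assms(2) m(1) by (intro gp_chain[OF assms(1)]) auto
    then show ?thesis using that by simp
  qed
  show ?thesis
    using *[of i j] *[of j i] assms gp_commute[of p "q i" "q j"]
    by (cases "i \<le> j") (auto simp: abs_minus_commute)
qed

definition quasigeodesic :: "real \<Rightarrow> (nat \<Rightarrow> 'a) \<Rightarrow> nat \<Rightarrow> bool" where
  "quasigeodesic L q n \<longleftrightarrow>
     (\<forall>i\<le>n. q i \<in> M) \<and> (\<forall>i<n. d (q i) (q (Suc i)) \<le> L) \<and>
     (\<forall>i\<le>n. \<forall>j\<le>n. \<bar>real i - real j\<bar> \<le> L * d (q i) (q j))"

text \<open>
  One half of the stability of quasigeodesics. Take the point \<open>m\<close> of the geodesic farthest from the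
  quasigeodesic, at distance about \<open>D\<close>. The geodesic points at distance about \<open>2 * D\<close> on either
  side of \<open>m\<close> are close to the quasigeodesic, which connects them by a path of length \<open>O(D)\<close>
  avoiding the ball of radius \<open>D\<close> around \<open>m\<close>. By \<open>gp_chain_between\<close> this forces
  \<open>D \<le> O(log D)\<close>, hence a bound on \<open>D\<close>.
\<close>

lemma geodesic_near_quasigeodesic:
  assumes L: "1 \<le> L"
  shows "\<exists>D::nat. \<forall>q n m. quasigeodesic L q n \<longrightarrow> m \<in> M \<longrightarrow>
           d (q 0) m + d m (q n) = d (q 0) (q n) \<longrightarrow> (\<exists>i\<le>n. d m (q i) \<le> real D)"
proof -
  \<comment> \<open>A violation at scale \<open>D\<close> will imply the opposite inequality.\<close>
  have "eventually (\<lambda>D::real. D > L/2 + \<delta> * (log 2 (L * (6 * D + 4)) + 3)) at_top"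
  proof (cases "\<delta> = 0")
    case True
    then show ?thesis by (auto intro: eventually_mono[OF eventually_gt_at_top[of "L/2"]])
  next
    case False
    then have "\<delta> > 0" "L > 0" using delta_nonneg L by auto
    then show ?thesis by real_asymp
  qed
  then obtain D0' where D0': "\<And>D. D \<ge> D0' \<Longrightarrow> D > L/2 + \<delta> * (log 2 (L * (6 * D + 4)) + 3)"
    by (auto simp: eventually_at_top_linorder)
  define D0 where "D0 = nat \<lceil>D0'\<rceil>"
  have "\<exists>i\<le>n. d m (q i) \<le> real D0"
    if q: "quasigeodesic L q n" and m0: "m \<in> M" "d (q 0) m + d m (q n) = d (q 0) (q n)" for m q n
  proof (rule ccontr)
    assume far: "\<not> ?thesis"
    define x y where "x = q 0" and "y = q n"
    note ends = this[symmetric]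
    have qM: "\<And>i. i \<le> n \<Longrightarrow> q i \<in> M"
      and step: "\<And>i. i < n \<Longrightarrow> d (q i) (q (Suc i)) \<le> L"
      and qg: "\<And>i j. i \<le> n \<Longrightarrow> j \<le> n \<Longrightarrow> \<bar>real i - real j\<bar> \<le> L * d (q i) (q j)"
      using q by (auto simp: quasigeodesic_def)
    have xy: "x \<in> M" "y \<in> M" using qM ends by auto
    \<comment> \<open>\<open>D\<close> is the largest integer such that some \<open>m\<close> on the geodesic has distance at least \<open>D\<close> to the quasigeodesic.\<close>
    define V where "V = {v::nat. \<exists>m\<in>M. d x m + d m y = d x y \<and> (\<forall>i\<le>n. real v \<le> d m (q i))}"
    have "D0 \<in> V" using far m0 unfolding V_def ends by force
    have "v \<le> nat \<lceil>d x y\<rceil>" if v: "v \<in> V" for v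
    proof -
      obtain m where m: "m \<in> M" "d x m + d m y = d x y" "\<forall>i\<le>n. real v \<le> d m (q i)"
        using v by (auto simp: V_def)
      have "real v \<le> d m x" using m(3) ends by auto
      also have "\<dots> \<le> d x y" using m(2) nonneg[of m y] commute[of x m] by linarith
      finally show ?thesis by linarith
    qed
    then have "finite V" by (meson finite_nat_set_iff_bounded_le)
    define D where "D = Max V"
    have DV: "D \<in> V" "D0 \<le> D"
      using Max_in[OF \<open>finite V\<close>] Max_ge[OF \<open>finite V\<close> \<open>D0 \<in> V\<close>] \<open>D0 \<in> V\<close> by (auto simp: D_def)
    have "Suc D \<notin> V"
      using Max_ge[OF \<open>finite V\<close>, of "Suc D"] by (auto simp: D_def)
    obtain m where m: "m \<in> M" "d x m + d m y = d x y" "\<And>i. i \<le> n \<Longrightarrow> real D \<le> d m (q i)"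
      using DV(1) by (auto simp: V_def)
    have near: "\<exists>i\<le>n. d m' (q i) \<le> real D + 1" if "m' \<in> M" "d x m' + d m' y = d x y" for m'
      using \<open>Suc D \<notin> V\<close> that unfolding V_def
      by (auto simp: not_le add.commute dest!: bspec[of _ _ m'] intro: less_imp_le)
    \<comment> \<open>On each side of \<open>m\<close>, walk back \<open>2 * D + 1\<close> or up to the end point if that is closer.\<close>
    have side: "\<exists>z'\<in>M. \<exists>i\<le>n. d z z' + d z' m = d z m \<and> real D \<le> gp m z' (q i) \<and>
        d z' m \<le> 2 * real D + 1 \<and> d z' (q i) \<le> real D + 1"
      if zw: "z = x \<and> w = y \<and> i0 = 0 \<or> z = y \<and> w = x \<and> i0 = n" for z w i0
    proof -
      have z: "z \<in> M" "w \<in> M" "q i0 = z" "i0 \<le> n" "d z m + d m w = d z w"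
        using zw xy ends m(2) commute by auto
      show ?thesis
      proof (cases "d m z \<le> 2 * real D + 1")
        case True
        then show ?thesis
          using z m(1) m(3)[of i0] commute[of z m]
          by (intro bexI[of _ z] exI[of _ i0]) (auto simp: gp_same)
      next
        case False
        then obtain z' where z': "z' \<in> M" "d m z' = real (2 * D + 1)" "d z' z = d m z - real (2 * D + 1)"
          using geodesic_point[OF m(1) z(1), of "2 * D + 1"] by auto
        have zz': "d z z' + d z' m = d z m" using z' commute[of z z'] commute[of z' m] commute[of m z] by simp
        have "d z' w \<le> d z' m + d m w" "d z w \<le> d z z' + d z' w" using triangle z z'(1) m(1) by auto
        then have "d z z' + d z' w = d z w" using zz' z(5) by simp
        then have "d x z' + d z' y = d x y"
          using zw commute[of x z'] commute[of y z'] commute[of x y] by auto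
        then obtain i where i: "i \<le> n" "d z' (q i) \<le> real D + 1"
          using near z'(1) by blast
        have "real D \<le> gp m z' (q i)"
          using i z'(2) m(3)[OF i(1)] commute[of z' m] commute[of "q i" m]
          by (simp add: gromov_product_def field_simps)
        then show ?thesis
          using z'(1,2) i zz' commute[of z' m]
          by (intro bexI[of _ z'] exI[of _ i]) auto
      qed
    qed
    obtain x' i where x': "x' \<in> M" "i \<le> n" "d x x' + d x' m = d x m" "real D \<le> gp m x' (q i)"
        "d x' m \<le> 2 * real D + 1" "d x' (q i) \<le> real D + 1"
      using side[of x y 0] by blast
    obtain y' j where y': "y' \<in> M" "j \<le> n" "d y y' + d y' m = d y m" "real D \<le> gp m y' (q j)"
        "d y' m \<le> 2 * real D + 1" "d y' (q j) \<le> real D + 1"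
      using side[of y x n] by blast
    have "gp m x' y' \<le> 0"
    proof -
      have "d x y \<le> d x x' + d x' y" "d x' y \<le> d x' y' + d y' y"
        using triangle xy x'(1) y'(1) by auto
      then show ?thesis
        using x'(3) y'(3) m(2) commute[of y y'] commute[of y m] by (simp add: gromov_product_def)
    qed
    have ij: "\<bar>real i - real j\<bar> \<le> L * (6 * real D + 4)"
    proof -
      have "d (q i) (q j) \<le> d (q i) x' + d x' (q j)" "d x' (q j) \<le> d x' y' + d y' (q j)"
           "d x' y' \<le> d x' m + d m y'"
        using triangle x' y' qM m(1) by auto
      then have "d (q i) (q j) \<le> 6 * real D + 4"
        using x'(5,6) y'(5,6) commute[of y' m] commute[of "q i" x'] by simp
      then have "L * d (q i) (q j) \<le> L * (6 * real D + 4)" using L by simp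
      then show ?thesis using qg[OF x'(2) y'(2)] by linarith
    qed
    \<comment> \<open>The part of the quasigeodesic between \<open>q i\<close> and \<open>q j\<close> has at most \<open>2 ^ k\<close> steps.\<close>
    define k where "k = nat \<lceil>log 2 (L * (6 * real D + 4))\<rceil>"
    have large: "1 \<le> L * (6 * real D + 4)"
      using L mult_mono[of 1 L 1 "6 * real D + 4"] by simp
    have k: "real k \<le> log 2 (L * (6 * real D + 4)) + 1" "log 2 (L * (6 * real D + 4)) \<le> real k"
      using large zero_le_log_cancel_iff[of 2 "L * (6 * real D + 4)"] unfolding k_def by linarith+
    have "L * (6 * real D + 4) \<le> 2 powr real k"
      using k(2) large by (subst (asm) log_le_iff) auto
    then have ijk: "\<bar>real i - real j\<bar> \<le> 2 ^ k"
      using ij by (simp add: powr_realpow)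
    have "(real D - L/2) - real k * \<delta> \<le> gp m (q i) (q j)"
    proof (rule gp_chain_between[OF m(1) qM _ _ x'(2) y'(2) ijk])
      fix i assume "i < n"
      then show "real D - L/2 \<le> gp m (q i) (q (Suc i))"
        using m(3)[of i] m(3)[of "Suc i"] step[of i] commute[of m "q i"] commute[of m "q (Suc i)"]
        by (simp add: gromov_product_def field_simps)
    next
      fix i assume "i \<le> n"
      then show "real D - L/2 \<le> d (q i) m" using m(3)[of i] commute[of m "q i"] L by simp
    qed
    moreover have "0 \<le> real k * \<delta>" using delta_nonneg by simp
    moreover have "min (gp m x' (q i)) (gp m (q i) y') - \<delta> \<le> gp m x' y'"
        "min (gp m (q i) (q j)) (gp m (q j) y') - \<delta> \<le> gp m (q i) y'"
      using four_point m(1) x'(1,2) y'(1,2) qM by auto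
    ultimately have "real D \<le> L/2 + (real k + 2) * \<delta>"
      using \<open>gp m x' y' \<le> 0\<close> x'(4) y'(4) L delta_nonneg gp_commute[of m y' "q j"]
        distrib_right[of "real k" 2 \<delta>] by linarith
    also have "\<dots> \<le> L/2 + (log 2 (L * (6 * real D + 4)) + 3) * \<delta>"
      using k(1) delta_nonneg by (intro add_left_mono mult_right_mono) auto
    also have "\<dots> < real D" using D0'[of "real D"] DV(2) unfolding D0_def
      by (simp add: mult.commute)
    finally show False by simp
  qed
  then show ?thesis by blast
qed

text \<open>
  The point \<open>c\<close> of the side from \<open>x\<close> to \<open>y\<close> at which a comparison tripod for \<open>x\<close>, \<open>y\<close>, \<open>z\<close>
  branches lies almost on the two other sides; the \<open>1\<close> pays for rounding the branching distance
  to an integer. It is also an almost nearest point to \<open>z\<close> on that side.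
\<close>

lemma center_of_triangle:
  assumes "x \<in> M" "y \<in> M" "z \<in> M" "c \<in> M" and c: "d x c + d c y = d x y"
    and le: "d x c \<le> gp x y z" "gp x y z \<le> d x c + 1"
  shows "gp c x z \<le> \<delta>" "gp c y z \<le> 1 + \<delta>" "d z c \<le> gp z x y + 2 * \<delta> + 1"
proof -
  have "min (gp x c y) (gp x y z) - \<delta> \<le> gp x c z"
    using four_point assms by auto
  moreover have "gp x c y = d x c"
    using c commute by (simp add: gromov_product_def)
  ultimately have "d x c - \<delta> \<le> gp x c z" using le by linarith
  then show "gp c x z \<le> \<delta>" "gp c y z \<le> 1 + \<delta>"
    using c le commute by (simp_all add: gromov_product_def field_simps)
  then show "d z c \<le> gp z x y + 2 * \<delta> + 1"
    using c commute by (simp add: gromov_product_def field_simps)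
qed

lemma obtain_center_of_triangle:
  assumes "x \<in> M" "y \<in> M" "z \<in> M"
  obtains c where "c \<in> M" "d x c + d c y = d x y" "gp c x z \<le> \<delta>" "gp c y z \<le> 1 + \<delta>"
    "d z c \<le> gp z x y + 2 * \<delta> + 1"
proof -
  define n where "n = nat \<lfloor>gp x y z\<rfloor>"
  have n: "real n \<le> gp x y z" "gp x y z \<le> real n + 1"
    using gp_nonneg[OF assms] unfolding n_def by linarith+
  then obtain c where c: "c \<in> M" "d x c = real n" "d c y = d x y - real n"
    using geodesic_point[of x y n] gp_le_dist[OF assms] commute[of x y] assms by force
  then have "d x c + d c y = d x y" by simp
  from center_of_triangle[OF assms c(1) this] show ?thesis
    using that[OF c(1)] c n by simp
qed

text \<open>
  Gromov products distort multiplicatively under a bilipschitz change of metric, so the four-point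
  condition cannot be transferred term by term. What survives with an additive error is the
  statement that a point \<open>m\<close> lies near a geodesic, i.e. that \<open>gp m x y\<close> is bounded, by
  \<open>geodesic_near_quasigeodesic\<close> applied to the geodesics of the new metric. The four-point
  condition follows from this alone: if \<open>d b e + d a f \<le> d a b + d e f\<close>, then geodesics from \<open>a\<close> to
  \<open>b\<close> and from \<open>e\<close> to \<open>f\<close> pass near a common point \<open>c\<close>, and the triangle inequality through
  \<open>c\<close> bounds the third sum \<open>d' a e + d' b f\<close> by \<open>d' a b + d' e f\<close> up to a constant.
\<close>

theorem gromov_hyperbolic_bilipschitz:
  assumes "discrete_geodesic_space M d'" and L: "1 \<le> L"
    and d'_le: "\<And>x y. x \<in> M \<Longrightarrow> y \<in> M \<Longrightarrow> d' x y \<le> L * d x y"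
    and d_le: "\<And>x y. x \<in> M \<Longrightarrow> y \<in> M \<Longrightarrow> d x y \<le> L * d' x y"
  shows "gromov_hyperbolic M d'"
proof -
  interpret D': discrete_geodesic_space M d' by fact
  obtain D :: nat where D: "\<And>q n m. quasigeodesic L q n \<Longrightarrow> m \<in> M \<Longrightarrow>
      d (q 0) m + d m (q n) = d (q 0) (q n) \<Longrightarrow> \<exists>i\<le>n. d m (q i) \<le> real D"
    using geodesic_near_quasigeodesic[OF L] by metis
  \<comment> \<open>\<open>A\<close> is the crossing constant of \<open>quadrilateral\<close> below.\<close>
  define A where "A = 1 + 3 * \<delta>"
  define B where "B = L * (A + 2 * \<delta> + 1 + real D)"
  have "0 \<le> A" "0 \<le> B" using delta_nonneg L by (auto simp: A_def B_def)
  have gp': "D'.gp m x y \<le> B"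
    if M: "x \<in> M" "y \<in> M" "m \<in> M" and le: "gp m x y \<le> A" for x y m
  proof -
    obtain c where c: "c \<in> M" "d x c + d c y = d x y" "d m c \<le> gp m x y + 2 * \<delta> + 1"
      using obtain_center_of_triangle[OF M] by metis
    obtain q n where q: "q 0 = x" "q n = y" "\<forall>i\<le>n. q i \<in> M" "d' x y = real n"
      "\<forall>i\<le>n. \<forall>j\<le>n. d' (q i) (q j) = \<bar>real i - real j\<bar>"
      using D'.geodesic_path[OF M(1,2)] .
    have "quasigeodesic L q n"
      unfolding quasigeodesic_def
    proof (intro conjI q(3) allI impI)
      fix i assume "i < n"
      then show "d (q i) (q (Suc i)) \<le> L"
        using d_le[of "q i" "q (Suc i)"] q(3,5) by simp
    next
      fix i j assume "i \<le> n" "j \<le> n"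
      then show "\<bar>real i - real j\<bar> \<le> L * d (q i) (q j)"
        using d'_le[of "q i" "q j"] q(3,5) by simp
    qed
    then have "\<exists>i\<le>n. d c (q i) \<le> real D"
      using D[of q n c] c(1,2) q(1,2) by simp
    then obtain i where i: "i \<le> n" "d c (q i) \<le> real D" by blast
    then have "d m (q i) \<le> A + 2 * \<delta> + 1 + real D"
      using triangle[of m c "q i"] c(1,3) le M(3) q(3) by fastforce
    then have "L * d m (q i) \<le> B" unfolding B_def using L by (intro mult_left_mono) auto
    then have "d' m (q i) \<le> B"
      using d'_le[of m "q i"] i(1) q(3) M(3) by fastforce
    moreover have "D'.gp (q i) x y = 0"
      using q(4) q(5)[rule_format, of 0 i] q(5)[rule_format, of n i] q(1,2) i(1) by (simp add: gromov_product_def of_nat_diff)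
    ultimately show ?thesis
      using D'.gp_change_base[OF M(3) q(3)[rule_format, OF i(1)] M(1,2)] by linarith
  qed
  have quadrilateral: "d' a e + d' b f \<le> d' a b + d' e f + 4 * B"
    if M: "a \<in> M" "b \<in> M" "e \<in> M" "f \<in> M" and ge: "d b e + d a f \<le> d a b + d e f" for a b e f
  proof -
    obtain c where c: "c \<in> M" "d a c + d c b = d a b" "gp c a e \<le> \<delta>" "gp c b e \<le> 1 + \<delta>"
      using obtain_center_of_triangle[OF M(1-3)] by metis
    have "min (gp c e f) (gp c f a) - \<delta> \<le> gp c e a" using four_point M c(1) by auto
    then have "gp c e f \<le> 2 * \<delta> \<or> gp c f a \<le> 2 * \<delta>" using c(3) gp_commute[of c a e] by linarith
    moreover have "gp c e f \<le> gp c b e + gp c f a"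
      using ge c(2) commute by (simp add: gromov_product_def field_simps)
    ultimately have "gp c e f \<le> A" using c(4) delta_nonneg unfolding A_def by linarith
    moreover have "gp c a b \<le> A"
      using c(2) \<open>0 \<le> A\<close> commute by (simp add: gromov_product_def)
    ultimately have "D'.gp c a b \<le> B" "D'.gp c e f \<le> B" using gp' M c(1) by auto
    moreover have "d' a e \<le> d' a c + d' e c" "d' b f \<le> d' b c + d' f c"
      using D'.triangle[of a c e] D'.triangle[of b c f] M c(1) D'.commute by auto
    ultimately show ?thesis by (simp add: gromov_product_def field_simps)
  qed
  have "min (D'.gp p x y) (D'.gp p y z) - 2 * B \<le> D'.gp p x z"
    if M: "p \<in> M" "x \<in> M" "y \<in> M" "z \<in> M" for p x y z
  proof (cases "d y z + d x p \<le> d x y + d z p")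
    case True
    then have "D'.gp p x y - 2 * B \<le> D'.gp p x z"
      using quadrilateral[OF M(2,3,4,1)] by (simp add: gromov_product_def field_simps)
    then show ?thesis by linarith
  next
    case False
    then have "D'.gp p y z - 2 * B \<le> D'.gp p x z"
      using quadrilateral[OF M(4,3,2,1)] commute[of y z] commute[of x y] commute[of x z]
        D'.commute[of y z] D'.commute[of x z] by (simp add: gromov_product_def field_simps)
    then show ?thesis by linarith
  qed
  then show ?thesis
    using \<open>0 \<le> B\<close> unfolding gromov_hyperbolic_def by (intro exI[of _ "2 * B"]) auto
qed

end

section \<open>Conjugation and finite index in groups\<close>

context group
begin

lemma cancel_left:
  "x \<in> carrier G \<Longrightarrow> y \<in> carrier G \<Longrightarrow> inv x \<otimes> (x \<otimes> y) = y"
  "x \<in> carrier G \<Longrightarrow> y \<in> carrier G \<Longrightarrow> x \<otimes> (inv x \<otimes> y) = y"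
  by (simp_all flip: m_assoc)

lemmas group_rules = m_assoc inv_mult_group cancel_left

lemma conjugacy_class_eq:
  "k \<in> carrier G \<Longrightarrow> conjugacy_class G k = (\<lambda>h. inv h \<otimes> k \<otimes> h) ` carrier G"
  unfolding conjugacy_class_def by (auto simp: image_iff) (metis inv_closed inv_inv)+

lemma self_in_conjugacy_class: "k \<in> carrier G \<Longrightarrow> k \<in> conjugacy_class G k"
  unfolding conjugacy_class_def by (auto intro!: exI[of _ \<one>])

lemma conjugacy_class_closed: "k \<in> carrier G \<Longrightarrow> conjugacy_class G k \<subseteq> carrier G"
  unfolding conjugacy_class_def by auto

lemma conjugacy_class_conj:
  assumes "k \<in> carrier G" "g \<in> carrier G" "x \<in> conjugacy_class G k"
  shows "g \<otimes> x \<otimes> inv g \<in> conjugacy_class G k"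
proof -
  obtain h where h: "h \<in> carrier G" "x = h \<otimes> k \<otimes> inv h"
    using assms(3) by (auto simp: conjugacy_class_def)
  then have "g \<otimes> x \<otimes> inv g = (g \<otimes> h) \<otimes> k \<otimes> inv (g \<otimes> h)"
    using assms(1,2) by (simp add: group_rules)
  then show ?thesis
    using h(1) assms(2) unfolding conjugacy_class_def by blast
qed

lemma finite_index:
  assumes "subgroup H G" "finite E" "E \<subseteq> carrier G"
    and cover: "\<And>x. x \<in> carrier G \<Longrightarrow> \<exists>y\<in>H. \<exists>e\<in>E. x = y \<otimes> e"
  shows "finite (rcosets H)"
proof -
  have HG: "H \<subseteq> carrier G" using assms(1) by (rule subgroup.subset)
  have "rcosets H \<subseteq> (\<lambda>e. H #> e) ` E"
  proof
    fix X assume "X \<in> rcosets H"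
    then obtain x where x: "x \<in> carrier G" "X = H #> x" by (auto simp: RCOSETS_def)
    then obtain y e where ye: "y \<in> H" "e \<in> E" "x = y \<otimes> e" using cover by blast
    then have "H #> x = (H #> y) #> e"
      using HG assms(3) by (simp add: coset_mult_assoc subset_iff)
    also have "H #> y = H" using ye(1) assms(1) HG by (intro coset_join2) auto
    finally show "X \<in> (\<lambda>e. H #> e) ` E" using x ye by auto
  qed
  then show ?thesis using assms(2) finite_surj by blast
qed

lemma intertwining_pow:
  assumes "g \<in> carrier G" "x \<in> carrier G" "y \<in> carrier G" "g \<otimes> x = y \<otimes> g"
  shows "g \<otimes> x [^] (n::nat) = y [^] n \<otimes> g"
proof (induction n)
  case (Suc n)
  have "g \<otimes> x [^] Suc n = (g \<otimes> x [^] n) \<otimes> x" using assms by (simp add: m_assoc)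
  also have "\<dots> = y [^] n \<otimes> (g \<otimes> x)" using assms Suc by (simp add: m_assoc)
  also have "\<dots> = y [^] Suc n \<otimes> g" using assms by (simp add: m_assoc)
  finally show ?case .
qed (use assms in simp)

end

section \<open>The word metric of a finitely generated group\<close>

locale finitely_generated_group = group G for G (structure) +
  fixes S :: "'a set"
  assumes generating: "finite_generating_set G S"
begin

abbreviation word_metric :: "'a \<Rightarrow> 'a \<Rightarrow> real"  (\<open>\<d>\<close>) where
  "\<d> \<equiv> word_dist G S"

abbreviation word_length :: "'a \<Rightarrow> real"  (\<open>\<ell>\<close>) where
  "\<ell> g \<equiv> real (word_norm G S g)"

lemma generators_carrier: "S \<subseteq> carrier G"
  using generating by (simp add: finite_generating_set_def)

lemma dist_one: "g \<in> carrier G \<Longrightarrow> \<d> \<one> g = \<ell> g"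
  by (simp add: word_dist_def)

lemma dist_eq: "g \<in> carrier G \<Longrightarrow> h \<in> carrier G \<Longrightarrow> \<d> g h = \<ell> (inv g \<otimes> h)"
  by (simp add: word_dist_def)

lemma dist_left_mult:
  "g \<in> carrier G \<Longrightarrow> x \<in> carrier G \<Longrightarrow> y \<in> carrier G \<Longrightarrow> \<d> (g \<otimes> x) (g \<otimes> y) = \<d> x y"
  by (simp add: word_dist_def group_rules)

end

sublocale finitely_generated_group \<subseteq> W: discrete_geodesic_space "carrier G" "word_dist G S"
proof -
  interpret M: Metric_space "carrier G" "word_dist G S"
    by (rule Metric_space_word_dist[OF generating])
  show "discrete_geodesic_space (carrier G) (word_dist G S)"
  proof
    fix x y n assume xy: "x \<in> carrier G" "y \<in> carrier G" and n: "real n \<le> \<d> x y"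
    obtain w where w: "represents G S w (inv x \<otimes> y)" "length w = word_norm G S (inv x \<otimes> y)"
      using word_norm_attained[OF generating, of "inv x \<otimes> y"] xy by auto
    define a b where "a = foldr (\<otimes>) (take n w) \<one>" and "b = foldr (\<otimes>) (drop n w) \<one>"
    have wG: "set w \<subseteq> carrier G"
      using represents_set[OF generators_carrier w(1)] by simp
    then have "set (take n w) \<subseteq> carrier G" "set (drop n w) \<subseteq> carrier G"
      using set_take_subset[of n w] set_drop_subset[of n w] by blast+
    then have ab: "a \<in> carrier G" "b \<in> carrier G"
      "foldr (\<otimes>) (take n w @ drop n w) \<one> = a \<otimes> b"
      using foldr_mult_closed foldr_mult_append unfolding a_def b_def by blast+
    then have "a \<otimes> b = inv x \<otimes> y" using w(1) by (simp add: represents_def)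
    then have y: "inv (x \<otimes> a) \<otimes> y = b"
      using ab(1,2) xy by (simp add: group_rules flip: \<open>a \<otimes> b = inv x \<otimes> y\<close>)
    have "represents G S (take n w) a" "represents G S (drop n w) b"
      using w(1) set_take_subset[of n w] set_drop_subset[of n w]
      unfolding represents_def a_def b_def by auto
    then have "word_norm G S a \<le> n" "word_norm G S b \<le> length w - n"
      using word_norm_le by fastforce+
    moreover have "\<d> x (x \<otimes> a) = \<ell> a" "\<d> (x \<otimes> a) y = \<ell> b" "\<d> x y = real (length w)"
      using xy ab y w(2) by (simp_all add: dist_eq cancel_left)
    moreover have "\<d> x y \<le> \<d> x (x \<otimes> a) + \<d> (x \<otimes> a) y"
      using M.triangle xy ab by simp
    ultimately show "\<exists>c\<in>carrier G. \<d> x c = real n \<and> \<d> c y = \<d> x y - real n"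
      using xy ab n by (intro bexI[of _ "x \<otimes> a"]) auto
  next
    fix x y assume "x \<in> carrier G" "y \<in> carrier G"
    then show "\<d> x y \<in> \<nat>" by (simp add: dist_eq)
  qed
qed

context finitely_generated_group
begin

lemma length_inv: "g \<in> carrier G \<Longrightarrow> \<ell> (inv g) = \<ell> g"
  using dist_eq[of g \<one>] dist_one[of g] W.commute[of g \<one>] by simp

lemma length_mult_le: "g \<in> carrier G \<Longrightarrow> h \<in> carrier G \<Longrightarrow> \<ell> (g \<otimes> h) \<le> \<ell> g + \<ell> h"
  using word_norm_mult_le[OF generating, of g h] by simp

lemma gp_left_mult:
  "g \<in> carrier G \<Longrightarrow> p \<in> carrier G \<Longrightarrow> x \<in> carrier G \<Longrightarrow> y \<in> carrier G \<Longrightarrow>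
     W.gp (g \<otimes> p) (g \<otimes> x) (g \<otimes> y) = W.gp p x y"
  by (simp add: gromov_product_def dist_left_mult)

lemma word_ball_eq: "word_ball G S n = {g \<in> carrier G. \<ell> g \<le> real n}"
  by (auto simp: word_ball_def W.in_mcball dist_one)

lemma finite_length_le: "finite {g \<in> carrier G. \<ell> g \<le> r}"
  by (rule finite_subset[OF _ finite_word_ball[OF generating, of "nat \<lceil>r\<rceil>"]])
     (use order_trans[OF _ real_nat_ceiling_ge] in \<open>fastforce simp: word_ball_eq\<close>)

lemma length_change_generators:
  assumes "finite_generating_set G T"
  shows "\<exists>L\<ge>1. \<forall>g\<in>carrier G. real (word_norm G T g) \<le> L * \<ell> g"
proof -
  define A where "A = S \<union> (\<lambda>s. inv s) ` S"
  have "finite A" "A \<subseteq> carrier G"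
    using generating generators_carrier by (auto simp: A_def finite_generating_set_def)
  define L where "L = Max (insert 1 (word_norm G T ` A))"
  have L: "1 \<le> L" "\<And>a. a \<in> A \<Longrightarrow> word_norm G T a \<le> L"
    using \<open>finite A\<close> by (auto simp: L_def)
  have *: "word_norm G T (foldr (\<otimes>) w \<one>) \<le> L * length w" if "set w \<subseteq> A" for w
    using that
  proof (induction w)
    case Nil
    then show ?case using word_norm_eq_0_iff[OF assms, of \<one>] by simp
  next
    case (Cons a w)
    have "word_norm G T (a \<otimes> foldr (\<otimes>) w \<one>)
        \<le> word_norm G T a + word_norm G T (foldr (\<otimes>) w \<one>)"
      using Cons.prems \<open>A \<subseteq> carrier G\<close>
      by (intro word_norm_mult_le[OF assms] foldr_mult_closed) auto
    then show ?case using Cons.IH Cons.prems L(2)[of a] by auto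
  qed
  have "word_norm G T g \<le> L * word_norm G S g" if "g \<in> carrier G" for g
  proof -
    obtain w where "represents G S w g" "length w = word_norm G S g"
      using word_norm_attained[OF generating \<open>g \<in> carrier G\<close>] .
    then show ?thesis using *[of w] by (auto simp: represents_def A_def)
  qed
  then have "real (word_norm G T g) \<le> real L * \<ell> g" if "g \<in> carrier G" for g
    using that by (metis of_nat_le_iff of_nat_mult)
  then show ?thesis using L(1) by (intro exI[of _ "real L"]) auto
qed

end

text \<open>
  Two finite generating sets give bilipschitz word metrics, so hyperbolicity may be used with the
  generating set in which lengths are counted.
\<close>

lemma (in group) word_hyperbolic_generating_set:
  assumes "word_hyperbolic G" "finite_generating_set G S"
  shows "gromov_hyperbolic (carrier G) (word_dist G S)"
proof -
  obtain T where T: "finite_generating_set G T" "gromov_hyperbolic (carrier G) (word_dist G T)"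
    using assms(1) by (auto simp: word_hyperbolic_def)
  interpret T: finitely_generated_group G T by unfold_locales fact
  interpret S: finitely_generated_group G S by unfold_locales fact
  obtain \<delta> where \<delta>: "\<delta> \<ge> 0" "\<forall>p\<in>carrier G. \<forall>x\<in>carrier G. \<forall>y\<in>carrier G. \<forall>z\<in>carrier G.
      gromov_product (word_dist G T) p x z \<ge>
        min (gromov_product (word_dist G T) p x y) (gromov_product (word_dist G T) p y z) - \<delta>"
    using T(2) by (auto simp: gromov_hyperbolic_def)
  interpret H: hyperbolic_geodesic_space "carrier G" "word_dist G T" \<delta>
    by unfold_locales (use \<delta> in auto)
  obtain L1 where L1: "L1 \<ge> 1" "\<forall>g\<in>carrier G. real (word_norm G T g) \<le> L1 * real (word_norm G S g)"
    using S.length_change_generators[OF T(1)] by blast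
  obtain L2 where L2: "L2 \<ge> 1" "\<forall>g\<in>carrier G. real (word_norm G S g) \<le> L2 * real (word_norm G T g)"
    using T.length_change_generators[OF assms(2)] by blast
  define L where "L = max L1 L2"
  have le: "L1 * real n \<le> L * real n" "L2 * real n \<le> L * real n" for n
    by (auto simp: L_def intro: mult_right_mono)
  show ?thesis
  proof (rule H.gromov_hyperbolic_bilipschitz[of _ L])
    show "discrete_geodesic_space (carrier G) (word_dist G S)" ..
    show "1 \<le> L" using L1 by (simp add: L_def)
    fix x y assume "x \<in> carrier G" "y \<in> carrier G"
    then show "word_dist G S x y \<le> L * word_dist G T x y" "word_dist G T x y \<le> L * word_dist G S x y"
      using L1(2)[rule_format, of "inv x \<otimes> y"] L2(2)[rule_format, of "inv x \<otimes> y"]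
        le(1)[of "word_norm G S (inv x \<otimes> y)"] le(2)[of "word_norm G T (inv x \<otimes> y)"]
      by (simp_all add: word_dist_def)
  qed
qed

locale hyperbolic_group = finitely_generated_group +
  fixes \<delta> :: real
  assumes hyp_delta_nonneg: "0 \<le> \<delta>"
  and hyp_four_point:
    "p \<in> carrier G \<Longrightarrow> x \<in> carrier G \<Longrightarrow> y \<in> carrier G \<Longrightarrow> z \<in> carrier G \<Longrightarrow>
       min (W.gp p x y) (W.gp p y z) - \<delta> \<le> W.gp p x z"

sublocale hyperbolic_group \<subseteq> W: hyperbolic_geodesic_space "carrier G" "word_dist G S" \<delta>
  by unfold_locales (use hyp_delta_nonneg hyp_four_point in auto)

context hyperbolic_group
begin

section \<open>Counting a conjugacy class from above\<close>

text \<open>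
  If \<open>g\<close> almost fixes the direction of \<open>h\<close> up to the distance of \<open>p\<close>, then it displaces \<open>p\<close> by
  an amount that depends on the length of \<open>g\<close> only. Applied to \<open>g = k\<close> this is the thin
  quadrilateral that controls a conjugate of \<open>k\<close>; applied along a ray it bounds displacements
  uniformly.
\<close>

lemma fellow_travel:
  assumes G: "g \<in> carrier G" "h \<in> carrier G" "p \<in> carrier G"
    and p: "\<d> \<one> p + \<d> p h = \<d> \<one> h" and le: "\<d> \<one> p \<le> W.gp \<one> h (g \<otimes> h)"
  shows "\<d> p (g \<otimes> p) \<le> 3 * \<ell> g + 4 * \<delta>"
proof -
  have gh: "W.gp \<one> p h = \<d> \<one> p" using p W.commute by (simp add: gromov_product_def)
  then have "W.gp g (g \<otimes> h) (g \<otimes> p) = \<d> \<one> p"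
    using gp_left_mult[of g \<one> p h] G W.gp_commute[of g] by simp
  then have "\<d> \<one> p - \<ell> g \<le> W.gp \<one> (g \<otimes> h) (g \<otimes> p)"
    using W.gp_change_base[of g \<one> "g \<otimes> h" "g \<otimes> p"] G by (simp add: dist_one W.commute[of g])
  moreover have "min (W.gp \<one> p h) (W.gp \<one> h (g \<otimes> p)) - \<delta> \<le> W.gp \<one> p (g \<otimes> p)"
    "min (W.gp \<one> h (g \<otimes> h)) (W.gp \<one> (g \<otimes> h) (g \<otimes> p)) - \<delta> \<le> W.gp \<one> h (g \<otimes> p)"
    using W.four_point G by auto
  moreover have "\<d> \<one> (g \<otimes> p) \<le> \<ell> g + \<d> \<one> p"
    using G length_mult_le[of g p] by (simp add: dist_one)
  moreover have "0 \<le> \<ell> g" by simp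
  ultimately have "\<d> \<one> p - \<ell> g - 2 * \<delta> \<le> W.gp \<one> p (g \<otimes> p)"
    using le gh W.delta_nonneg by linarith
  then show ?thesis
    using \<open>\<d> \<one> (g \<otimes> p) \<le> \<ell> g + \<d> \<one> p\<close> W.commute[of p \<one>] W.commute[of "g \<otimes> p" \<one>]
    by (simp add: gromov_product_def field_simps)
qed

text \<open>
  Otherwise the geodesic from \<open>\<one>\<close> to \<open>h\<close> and its translate by \<open>k\<close> stay together for a long time,
  and the short elements \<open>inv (q i) \<otimes> k \<otimes> q i\<close> along it repeat by the pigeonhole principle.
  Cutting out the piece of the geodesic between two equal ones multiplies \<open>h\<close> from the left by an
  element commuting with \<open>k\<close> and gives a shorter conjugator.
\<close>

lemma shortest_conjugator:
  assumes G: "k \<in> carrier G" "h \<in> carrier G"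
    and shortest: "\<And>h'. h' \<in> carrier G \<Longrightarrow> inv h' \<otimes> k \<otimes> h' = inv h \<otimes> k \<otimes> h \<Longrightarrow> \<ell> h \<le> \<ell> h'"
  shows "2 * \<ell> h \<le> \<ell> (inv h \<otimes> k \<otimes> h) + \<ell> k + 2 * card {x \<in> carrier G. \<ell> x \<le> 3 * \<ell> k + 4 * \<delta>}"
proof -
  define X where "X = {x \<in> carrier G. \<ell> x \<le> 3 * \<ell> k + 4 * \<delta>}"
  have "finite X" unfolding X_def by (rule finite_length_le)
  have "W.gp \<one> h (k \<otimes> h) < card X"
  proof (rule ccontr)
    assume "\<not> W.gp \<one> h (k \<otimes> h) < card X"
    then have large: "card X \<le> W.gp \<one> h (k \<otimes> h)" by simp
    obtain q n where q: "q 0 = \<one>" "q n = h" "\<forall>i\<le>n. q i \<in> carrier G" "\<d> \<one> h = real n"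
        "\<forall>i\<le>n. \<forall>j\<le>n. \<d> (q i) (q j) = \<bar>real i - real j\<bar>"
      using W.geodesic_path[of \<one> h] G by auto
    have "card X \<le> n"
      using large W.gp_le_dist[of \<one> h "k \<otimes> h"] G q(4) W.commute[of h \<one>] by simp
    have "inv (q i) \<otimes> k \<otimes> q i \<in> X" if i: "i \<le> card X" for i
    proof -
      have "i \<le> n" using i \<open>card X \<le> n\<close> by simp
      then have qi: "q i \<in> carrier G" "\<d> \<one> (q i) = real i" "\<d> (q i) h = real n - real i"
        using q by (auto simp flip: q(1,2))
      then have "\<d> (q i) (k \<otimes> q i) \<le> 3 * \<ell> k + 4 * \<delta>"
        using i large q(4) by (intro fellow_travel[OF G]) auto
      then show ?thesis using qi G by (simp add: X_def dist_eq m_assoc)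
    qed
    then have "(\<lambda>i. inv (q i) \<otimes> k \<otimes> q i) ` {..card X} \<subseteq> X" by auto
    then have "\<not> inj_on (\<lambda>i. inv (q i) \<otimes> k \<otimes> q i) {..card X}"
      using card_inj_on_le[OF _ _ \<open>finite X\<close>, of _ "{..card X}"] by force
    then obtain i j where ij: "i < j" "j \<le> card X"
        and eq: "inv (q i) \<otimes> k \<otimes> q i = inv (q j) \<otimes> k \<otimes> q j"
      unfolding inj_on_def by (metis atMost_iff linorder_neqE_nat)
    have jn: "i \<le> n" "j \<le> n" using ij \<open>card X \<le> n\<close> by auto
    have qG: "q i \<in> carrier G" "q j \<in> carrier G" using q(3) jn by auto
    \<comment> \<open>The end point of the geodesic to \<open>h\<close> after the piece from \<open>q i\<close> to \<open>q j\<close> is cut out.\<close>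
    define h' where "h' = q i \<otimes> (inv (q j) \<otimes> h)"
    have h': "h' \<in> carrier G" using qG G by (simp add: h'_def)
    have "inv h' \<otimes> k \<otimes> h' = inv h \<otimes> q j \<otimes> (inv (q i) \<otimes> k \<otimes> q i) \<otimes> (inv (q j) \<otimes> h)"
      using qG G by (simp add: h'_def group_rules)
    also have "\<dots> = inv h \<otimes> k \<otimes> h"
      unfolding eq using qG G by (simp add: group_rules)
    finally have "\<ell> h \<le> \<ell> h'" using shortest[OF h'] by simp
    moreover have "\<ell> h' \<le> real i + (real n - real j)"
    proof -
      have "\<ell> (q i) = real i" "\<ell> (inv (q j) \<otimes> h) = real n - real j"
        using q(5)[rule_format, of 0 i] q(5)[rule_format, of j n] jn q(1,2) qG G
        by (auto simp: dist_one simp flip: dist_eq)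
      then show ?thesis
        using length_mult_le[of "q i" "inv (q j) \<otimes> h"] qG G by (simp add: h'_def)
    qed
    moreover have "\<ell> h = real n" using q(4) G by (simp add: dist_one)
    ultimately show False using ij by simp
  qed
  moreover have "\<ell> h \<le> \<ell> k + \<ell> (k \<otimes> h)"
    using length_mult_le[of "inv k" "k \<otimes> h"] G by (simp add: cancel_left length_inv)
  moreover have "\<d> h (k \<otimes> h) = \<ell> (inv h \<otimes> k \<otimes> h)"
    using G by (simp add: dist_eq m_assoc)
  ultimately show ?thesis
    using G W.commute[of _ \<one>] by (simp add: gromov_product_def dist_one X_def field_simps)
qed

text \<open>
  A conjugate of length \<open>n\<close> is determined by a shortest conjugator, whose length is at most
  \<open>n / 2\<close> up to an additive constant.
\<close>

theorem conj_count_le_ball: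
  assumes k: "k \<in> carrier G"
  shows "\<exists>C. \<forall>n. conj_count G (conjugacy_class G k) S n \<le> card (word_ball G S (n div 2 + C))"
proof -
  define D where "D = word_norm G S k + card {x \<in> carrier G. \<ell> x \<le> 3 * \<ell> k + 4 * \<delta>} + 1"
  have "conj_count G (conjugacy_class G k) S n \<le> card (word_ball G S (n div 2 + D))" for n
  proof -
    have "conjugacy_class G k \<inter> word_ball G S n
        \<subseteq> (\<lambda>h. inv h \<otimes> k \<otimes> h) ` word_ball G S (n div 2 + D)"
    proof
      fix x assume x: "x \<in> conjugacy_class G k \<inter> word_ball G S n"
      then have "\<exists>h. h \<in> carrier G \<and> inv h \<otimes> k \<otimes> h = x"
        using conjugacy_class_eq[OF k] by auto
      then obtain h where h: "h \<in> carrier G" "inv h \<otimes> k \<otimes> h = x"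
        "\<And>h'. h' \<in> carrier G \<Longrightarrow> inv h' \<otimes> k \<otimes> h' = x \<Longrightarrow> word_norm G S h \<le> word_norm G S h'"
        using ex_has_least_nat[of "\<lambda>h. h \<in> carrier G \<and> inv h \<otimes> k \<otimes> h = x" _ "word_norm G S"]
        by metis
      have "2 * \<ell> h \<le> \<ell> x + \<ell> k + 2 * card {x \<in> carrier G. \<ell> x \<le> 3 * \<ell> k + 4 * \<delta>}"
        using shortest_conjugator[OF k h(1)] h(2,3) by simp
      also have "\<dots> \<le> real n + 2 * real D - 2"
        using x by (simp add: word_ball_eq D_def)
      finally have "\<ell> h \<le> real (n div 2 + D)" by linarith
      then show "x \<in> (\<lambda>h. inv h \<otimes> k \<otimes> h) ` word_ball G S (n div 2 + D)"
        using h(1,2) by (auto simp: word_ball_eq)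
    qed
    then show ?thesis
      unfolding conj_count_def using finite_word_ball[OF generating] surj_card_le by blast
  qed
  then show ?thesis by blast
qed

section \<open>Finite conjugacy classes act trivially at infinity\<close>

lemma asymptotic_iff:
  "asymptotic \<d> \<one> u v \<longleftrightarrow> (\<forall>Z. \<exists>N. \<forall>i\<ge>N. \<forall>j\<ge>N. Z \<le> W.gp \<one> (u i) (v j))"
  unfolding asymptotic_def filterlim_at_top eventually_prod_sequentially by fast

lemma asymptotic_sym: "asymptotic \<d> \<one> u v \<Longrightarrow> asymptotic \<d> \<one> v u"
  unfolding asymptotic_iff by (subst W.gp_commute) blast

lemma asymptotic_trans:
  assumes "range u \<subseteq> carrier G" "range v \<subseteq> carrier G" "range w \<subseteq> carrier G"
    and uv: "asymptotic \<d> \<one> u v" and vw: "asymptotic \<d> \<one> v w"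
  shows "asymptotic \<d> \<one> u w"
  unfolding asymptotic_iff
proof
  fix Z
  obtain N1 N2 where N: "\<forall>i\<ge>N1. \<forall>j\<ge>N1. Z + \<delta> \<le> W.gp \<one> (u i) (v j)"
      "\<forall>i\<ge>N2. \<forall>j\<ge>N2. Z + \<delta> \<le> W.gp \<one> (v i) (w j)"
    using uv vw unfolding asymptotic_iff by meson
  have "Z \<le> W.gp \<one> (u i) (w j)" if "max N1 N2 \<le> i" "max N1 N2 \<le> j" for i j
  proof -
    have "min (W.gp \<one> (u i) (v i)) (W.gp \<one> (v i) (w j)) - \<delta> \<le> W.gp \<one> (u i) (w j)"
      using assms(1-3) by (intro W.four_point) auto
    then show ?thesis using N that by fastforce
  qed
  then show "\<exists>N. \<forall>i\<ge>N. \<forall>j\<ge>N. Z \<le> W.gp \<one> (u i) (w j)" by blast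
qed

lemma asymptotic_bounded_change:
  assumes "range u \<subseteq> carrier G" "range u' \<subseteq> carrier G" "range v \<subseteq> carrier G"
    and bound: "\<And>n. \<d> (u n) (u' n) \<le> B" and uv: "asymptotic \<d> \<one> u v"
  shows "asymptotic \<d> \<one> u' v"
  unfolding asymptotic_iff
proof
  fix Z
  obtain N where N: "\<forall>i\<ge>N. \<forall>j\<ge>N. Z + B \<le> W.gp \<one> (u i) (v j)"
    using uv unfolding asymptotic_iff by meson
  have "W.gp \<one> (u i) (v j) \<le> W.gp \<one> (u' i) (v j) + B" for i j
    using W.gp_change_point[of \<one> "u i" "u' i" "v j"] bound[of i] assms(1-3) by force
  then show "\<exists>N. \<forall>i\<ge>N. \<forall>j\<ge>N. Z \<le> W.gp \<one> (u' i) (v j)"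
    using N by (smt (verit))
qed

text \<open>
  The displacement of \<open>v\<close> under \<open>k\<close> is the length of a conjugate of \<open>k\<close>. If there are finitely
  many conjugates, \<open>k\<close> moves all points by a bounded amount and hence fixes every point at infinity.
\<close>

theorem finite_conjugacy_class_virtual_center:
  assumes k: "k \<in> carrier G" and fin: "finite (conjugacy_class G k)"
  shows "k \<in> virtual_center G S"
proof -
  let ?R = "asymptotic_rel (carrier G) \<d> \<one>"
  define B where "B = Max (\<ell> ` conjugacy_class G k)"
  have B: "\<d> v (k \<otimes> v) \<le> B" if "v \<in> carrier G" for v
    using that k fin conjugacy_class_eq[OF k] unfolding B_def
    by (intro Max_ge) (auto simp: dist_eq m_assoc)
  have sym: "(v, u) \<in> ?R" if "(u, v) \<in> ?R" for u v
    using that asymptotic_sym by (auto simp: asymptotic_rel_def)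
  have trans: "(u, w) \<in> ?R" if "(u, v) \<in> ?R" "(v, w) \<in> ?R" for u v w
    using that asymptotic_trans[of u v w]
    by (auto simp: asymptotic_rel_def sequences_to_infinity_def)
  have shift: "((\<lambda>n. k \<otimes> u n), v) \<in> ?R" if "(u, v) \<in> ?R" for u v
  proof -
    let ?ku = "\<lambda>n. k \<otimes> u n"
    have uv: "range u \<subseteq> carrier G" "range v \<subseteq> carrier G" "asymptotic \<d> \<one> u u" "asymptotic \<d> \<one> u v"
      "v \<in> sequences_to_infinity (carrier G) \<d> \<one>"
      using that by (auto simp: asymptotic_rel_def sequences_to_infinity_def)
    have ku: "range ?ku \<subseteq> carrier G" using uv(1) k by auto
    have bound: "\<d> (u n) (?ku n) \<le> B" for n using B uv(1) by auto
    have "asymptotic \<d> \<one> ?ku v" "asymptotic \<d> \<one> ?ku u"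
      using asymptotic_bounded_change[OF _ ku _ bound] uv by auto
    moreover from this(2) have "asymptotic \<d> \<one> ?ku ?ku"
      using asymptotic_bounded_change[OF _ ku ku bound] uv(1) asymptotic_sym by blast
    ultimately show ?thesis
      using ku uv(5) by (auto simp: asymptotic_rel_def sequences_to_infinity_def)
  qed
  have "boundary_action G S k \<xi> = \<xi>" if "\<xi> \<in> group_boundary G S" for \<xi>
  proof -
    obtain u where u: "u \<in> sequences_to_infinity (carrier G) \<d> \<one>" "\<xi> = ?R `` {u}"
      using \<open>\<xi> \<in> group_boundary G S\<close> by (auto simp: group_boundary_def gromov_boundary_def quotient_def)
    then have "(u, u) \<in> ?R" by (auto simp: asymptotic_rel_def sequences_to_infinity_def)
    show ?thesis
    proof (intro equalityI subsetI)
      fix w assume "w \<in> boundary_action G S k \<xi>"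
      then obtain v where v: "(u, v) \<in> ?R" "((\<lambda>n. k \<otimes> v n), w) \<in> ?R"
        by (auto simp: boundary_action_def u(2))
      then show "w \<in> \<xi>" using trans[OF sym[OF shift[OF sym[OF v(1)]]] v(2)] u(2) by simp
    next
      fix w assume "w \<in> \<xi>"
      then show "w \<in> boundary_action G S k \<xi>"
        using shift[of u w] \<open>(u, u) \<in> ?R\<close> by (auto simp: boundary_action_def u(2))
    qed
  qed
  then show ?thesis using k by (simp add: virtual_center_def)
qed

end

section \<open>Elements that fix the end of a geodesic ray\<close>

text \<open>
  Koenig's lemma for the locally finite Cayley graph: at each step one of the finitely many
  neighbours lies on geodesics to infinitely many of the points that the ray has followed so far.
\<close>

lemma (in finitely_generated_group) geodesic_ray_limit:
  assumes h: "\<And>m. h m \<in> carrier G" "\<And>m. real m \<le> \<ell> (h m)"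
  obtains p where "p 0 = \<one>" "\<And>i. p i \<in> carrier G" "\<And>i j. \<d> (p i) (p j) = \<bar>real i - real j\<bar>"
    "\<And>i. infinite {m. \<d> \<one> (p i) + \<d> (p i) (h m) = \<d> \<one> (h m)}"
proof -
  define P where "P i x \<longleftrightarrow> x \<in> carrier G \<and> \<d> \<one> x = real i \<and> (i = 0 \<longrightarrow> x = \<one>) \<and>
      infinite {m. \<d> \<one> x + \<d> x (h m) = \<d> \<one> (h m)}" for i :: nat and x
  have step: "\<exists>y. P (Suc i) y \<and> \<d> x y = 1" if "P i x" for i x
  proof -
    have x: "x \<in> carrier G" "\<d> \<one> x = real i" using that by (auto simp: P_def)
    define I where "I = {m. \<d> \<one> x + \<d> x (h m) = \<d> \<one> (h m)} - {..i}"
    have "infinite {m. \<d> \<one> x + \<d> x (h m) = \<d> \<one> (h m)}" using that unfolding P_def by blast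
    then have "infinite I" unfolding I_def by (rule Diff_infinite_finite[rotated]) simp
    have "\<exists>y\<in>carrier G. \<d> x y = 1 \<and> \<d> y (h m) = \<d> x (h m) - 1" if "m \<in> I" for m
    proof -
      have "1 \<le> \<d> x (h m)" using that x h[of m] by (auto simp: I_def dist_one)
      then show ?thesis using W.geodesic_point[of x "h m" 1] x h by simp
    qed
    then obtain y where y: "\<And>m. m \<in> I \<Longrightarrow> y m \<in> carrier G \<and> \<d> x (y m) = 1 \<and> \<d> (y m) (h m) = \<d> x (h m) - 1"
      by metis
    have 1: "\<d> \<one> (y m) = real (Suc i) \<and> \<d> \<one> (y m) + \<d> (y m) (h m) = \<d> \<one> (h m)" if "m \<in> I" for m
      using W.triangle[of \<one> x "y m"] W.triangle[of \<one> "y m" "h m"] x h(1)[of m] y[OF that] that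
      by (auto simp: I_def)
    have "y ` I \<subseteq> {g \<in> carrier G. \<ell> g \<le> real (Suc i)}"
    proof (rule image_subsetI)
      fix m assume "m \<in> I"
      then show "y m \<in> {g \<in> carrier G. \<ell> g \<le> real (Suc i)}"
        using 1[of m] y[of m] by (simp add: dist_one)
    qed
    then have "finite (y ` I)" using finite_length_le finite_subset by blast
    then obtain m0 where m0: "m0 \<in> I" "infinite {m \<in> I. y m = y m0}"
      using pigeonhole_infinite[OF \<open>infinite I\<close>] by blast
    have "{m \<in> I. y m = y m0} \<subseteq> {m. \<d> \<one> (y m0) + \<d> (y m0) (h m) = \<d> \<one> (h m)}"
      using 1 by force
    then have "infinite {m. \<d> \<one> (y m0) + \<d> (y m0) (h m) = \<d> \<one> (h m)}"
      using m0(2) finite_subset by blast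
    then show ?thesis
      using 1[OF m0(1)] y[OF m0(1)] by (intro exI[of _ "y m0"]) (auto simp: P_def)
  qed
  have "P 0 \<one>" using h(1) by (simp add: P_def)
  then obtain p where p: "\<And>i. P i (p i)" "\<And>i. \<d> (p i) (p (Suc i)) = 1"
    using dependent_nat_choice[of P "\<lambda>_ x y. \<d> x y = 1"] step by metis
  have pG: "p i \<in> carrier G" for i using p(1) by (simp add: P_def)
  have "\<d> (p i) (p (i + n)) = real n" for i n
  proof (rule antisym)
    show "\<d> (p i) (p (i + n)) \<le> real n"
    proof (induction n)
      case 0
      then show ?case using pG by simp
    next
      case (Suc n)
      then show ?case using W.triangle[of "p i" "p (i + n)" "p (i + Suc n)"] pG p(2)[of "i + n"] by simp
    qed
    show "real n \<le> \<d> (p i) (p (i + n))"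
      using W.triangle[of \<one> "p i" "p (i + n)"] pG p(1)[of i] p(1)[of "i + n"] by (simp add: P_def)
  qed
  note dist = this
  have "\<d> (p i) (p j) = \<bar>real i - real j\<bar>" for i j
    using dist[of i "j - i"] dist[of j "i - j"] W.commute[of "p i" "p j"] by (cases "i \<le> j") auto
  then show ?thesis using that[of p] p(1) pG unfolding P_def by blast
qed

locale hyperbolic_group_ray = hyperbolic_group +
  fixes p :: "nat \<Rightarrow> 'a"
  assumes ray_start: "p 0 = \<one>"
  and ray_carrier [simp, intro]: "p i \<in> carrier G"
  and ray_geodesic: "\<d> (p i) (p j) = \<bar>real i - real j\<bar>"
begin

text \<open>
  The stabilizer of the point at infinity determined by the ray.
\<close>

definition ray_stabilizer :: "'a set" where
  "ray_stabilizer = {g \<in> carrier G. \<exists>B. \<forall>i. \<d> (p i) (g \<otimes> p i) \<le> B}"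

text \<open>
  The summand \<open>4 * \<delta> + 1\<close> is the distance of a translate to the ray in \<open>translate_near_ray\<close>; four
  more are lost when the shifts at different indices are compared.
\<close>

definition shift_error :: real where
  "shift_error = 5 * (4 * \<delta> + 1)"

text \<open>
  \<open>g\<close> moves the far part of the ray along itself by \<open>s\<close>, up to an error that does not depend on
  \<open>g\<close>. The integer \<open>s\<close> is a coarse value of the Busemann cocycle at the end of the ray. Only
  large \<open>i\<close> matter, so the truncation of negative indices by \<open>nat\<close> is harmless.
\<close>

definition shifts_ray :: "'a \<Rightarrow> int \<Rightarrow> bool" where
  "shifts_ray g s \<longleftrightarrow> (\<exists>I. \<forall>i\<ge>I. \<d> (g \<otimes> p i) (p (nat (int i + s))) \<le> shift_error)"

lemma shift_error_pos: "0 < shift_error"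
  using hyp_delta_nonneg by (simp add: shift_error_def)

lemma ray_stabilizer_carrier: "g \<in> ray_stabilizer \<Longrightarrow> g \<in> carrier G"
  by (simp add: ray_stabilizer_def)

lemma ray_stabilizer_inv: "g \<in> ray_stabilizer \<Longrightarrow> inv g \<in> ray_stabilizer"
proof -
  assume g: "g \<in> ray_stabilizer"
  then have "\<d> (p i) (inv g \<otimes> p i) = \<d> (p i) (g \<otimes> p i)" for i
    using dist_left_mult[of g "p i" "inv g \<otimes> p i"] W.commute[of "p i" "g \<otimes> p i"]
    by (simp add: cancel_left ray_stabilizer_carrier)
  then show ?thesis using g by (simp add: ray_stabilizer_def)
qed

lemma ray_stabilizer_mult:
  assumes "g \<in> ray_stabilizer" "h \<in> ray_stabilizer"
  shows "g \<otimes> h \<in> ray_stabilizer"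
proof -
  note G = assms[THEN ray_stabilizer_carrier]
  obtain A B where AB: "\<And>i. \<d> (p i) (g \<otimes> p i) \<le> A" "\<And>i. \<d> (p i) (h \<otimes> p i) \<le> B"
    using assms by (auto simp: ray_stabilizer_def)
  have "\<d> (p i) (g \<otimes> h \<otimes> p i) \<le> A + B" for i
    using W.triangle[of "p i" "g \<otimes> p i" "g \<otimes> h \<otimes> p i"] AB[of i]
      dist_left_mult[of g "p i" "h \<otimes> p i"] G by (simp add: m_assoc)
  then show ?thesis using G by (auto simp: ray_stabilizer_def)
qed

lemma ray_stabilizer_pow: "g \<in> ray_stabilizer \<Longrightarrow> g [^] (n::nat) \<in> ray_stabilizer"
proof (induction n)
  case 0
  then show ?case by (auto simp: ray_stabilizer_def intro!: exI[of _ 0])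
next
  case (Suc n)
  then show ?case by (simp add: ray_stabilizer_mult)
qed

text \<open>
  In the quadrilateral with vertices \<open>\<one>\<close>, \<open>p J\<close>, \<open>g \<otimes> p J\<close> and \<open>g\<close>, a point of the side from \<open>g\<close>
  to \<open>g \<otimes> p J\<close> far from the two short sides is near the opposite side, with a bound
  independent of \<open>g\<close> and of \<open>B\<close>.
\<close>

lemma translate_near_ray:
  assumes g: "g \<in> carrier G" and B: "\<And>i. \<d> (p i) (g \<otimes> p i) \<le> B" and i: "\<ell> g + 2 * \<delta> < real i"
  shows "\<exists>t. \<d> (g \<otimes> p i) (p t) \<le> 4 * \<delta> + 1"
proof -
  \<comment> \<open>Far enough for the short side from \<open>p J\<close> to \<open>g \<otimes> p J\<close> to be invisible from \<open>g \<otimes> p i\<close>.\<close>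
  define J where "J = i + nat \<lceil>B + 2 * \<delta>\<rceil> + 1"
  have J: "B + 2 * \<delta> < real J - real i" "i < J" unfolding J_def by linarith+
  let ?x = "g \<otimes> p i"
  have x: "?x \<in> carrier G" "g \<otimes> p J \<in> carrier G" using g by auto
  have gx: "\<d> g ?x = real i" "\<d> (g \<otimes> p J) ?x = real J - real i"
    using dist_left_mult[of g \<one> "p i"] dist_left_mult[of g "p J" "p i"] g J
      ray_geodesic[of 0 i] ray_geodesic[of J i] by (simp_all add: ray_start)
  have zero: "W.gp ?x g (g \<otimes> p J) = 0"
    using gx dist_left_mult[of g \<one> "p J"] g ray_geodesic[of 0 J]
    by (simp add: gromov_product_def ray_start)
  have "\<d> g ?x \<le> \<d> g \<one> + \<d> \<one> ?x" using W.triangle g x by simp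
  then have "real i - \<ell> g \<le> W.gp ?x g \<one>"
    using gx g dist_one[OF g] W.commute[of g \<one>] by (simp add: gromov_product_def)
  moreover have "min (W.gp ?x g \<one>) (W.gp ?x \<one> (g \<otimes> p J)) - \<delta> \<le> W.gp ?x g (g \<otimes> p J)"
    using W.four_point g x by simp
  ultimately have 1: "W.gp ?x \<one> (g \<otimes> p J) \<le> \<delta>"
    using i zero hyp_delta_nonneg by (auto simp: min_def split: if_splits)
  have "\<d> (g \<otimes> p J) ?x \<le> \<d> (g \<otimes> p J) (p J) + \<d> (p J) ?x" using W.triangle g x by simp
  then have "real J - real i - B \<le> W.gp ?x (p J) (g \<otimes> p J)"
    using gx B[of J] W.commute[of "p J" "g \<otimes> p J"] by (simp add: gromov_product_def)
  moreover have "min (W.gp ?x \<one> (p J)) (W.gp ?x (p J) (g \<otimes> p J)) - \<delta> \<le> W.gp ?x \<one> (g \<otimes> p J)"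
    using W.four_point g x by simp
  ultimately have 2: "W.gp ?x \<one> (p J) \<le> 2 * \<delta>"
    using 1 J by linarith
  define t where "t = nat \<lfloor>W.gp \<one> (p J) ?x\<rfloor>"
  have t: "real t \<le> W.gp \<one> (p J) ?x" "W.gp \<one> (p J) ?x \<le> real t + 1"
    using W.gp_nonneg[OF one_closed ray_carrier[of J] x(1)] unfolding t_def by linarith+
  have "real t \<le> real J"
    using t(1) W.gp_le_dist[of \<one> "p J" ?x] x(1) ray_geodesic[of J 0] by (simp add: ray_start)
  then have "\<d> ?x (p t) \<le> W.gp ?x \<one> (p J) + 2 * \<delta> + 1"
    using t x(1) ray_geodesic[of 0 t] ray_geodesic[of 0 J] ray_geodesic[of t J]
    by (intro W.center_of_triangle(3)) (auto simp: ray_start)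
  then show ?thesis using 2 by (intro exI[of _ t]) simp
qed

text \<open>
  If \<open>g \<otimes> p i\<close> is near \<open>p (t i)\<close>, then \<open>t\<close> preserves distances up to an error and stays at
  bounded distance from the identity, so comparing with a far index \<open>j\<close> excludes that \<open>t\<close> reverses
  the direction; hence \<open>t i - i\<close> is almost constant.
\<close>

lemma stabilizer_shifts_ray:
  assumes "g \<in> ray_stabilizer"
  shows "\<exists>s. shifts_ray g s"
proof -
  have g: "g \<in> carrier G" using assms by (rule ray_stabilizer_carrier)
  obtain B where B: "\<And>i. \<d> (p i) (g \<otimes> p i) \<le> B"
    using assms by (auto simp: ray_stabilizer_def)
  define c where "c = 4 * \<delta> + 1"
  define I where "I = nat \<lceil>\<ell> g + 2 * \<delta>\<rceil> + 1"
  have "\<exists>t. \<d> (g \<otimes> p i) (p t) \<le> c" if "I \<le> i" for i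
  proof -
    have "\<ell> g + 2 * \<delta> < real i" using that unfolding I_def by linarith
    then show ?thesis unfolding c_def by (rule translate_near_ray[OF g B])
  qed
  then obtain t where t: "\<And>i. I \<le> i \<Longrightarrow> \<d> (g \<otimes> p i) (p (t i)) \<le> c" by metis
  have tB: "\<bar>real (t i) - real i\<bar> \<le> B + c" if "I \<le> i" for i
    using W.triangle[of "p i" "g \<otimes> p i" "p (t i)"] B[of i] t[OF that] g
      ray_geodesic[of i "t i"] by (simp add: abs_minus_commute)
  have tt: "\<bar>\<bar>real (t i) - real (t j)\<bar> - \<bar>real i - real j\<bar>\<bar> \<le> 2 * c" if "I \<le> i" "I \<le> j" for i j
  proof -
    have "\<d> (g \<otimes> p i) (g \<otimes> p j) = \<bar>real i - real j\<bar>" using g by (simp add: dist_left_mult ray_geodesic)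
    moreover have
      "\<d> (g \<otimes> p i) (g \<otimes> p j) \<le> \<d> (g \<otimes> p i) (p (t i)) + \<d> (p (t i)) (g \<otimes> p j)"
      "\<d> (p (t i)) (g \<otimes> p j) \<le> \<d> (p (t i)) (p (t j)) + \<d> (p (t j)) (g \<otimes> p j)"
      "\<d> (p (t i)) (p (t j)) \<le> \<d> (p (t i)) (g \<otimes> p i) + \<d> (g \<otimes> p i) (p (t j))"
      "\<d> (g \<otimes> p i) (p (t j)) \<le> \<d> (g \<otimes> p i) (g \<otimes> p j) + \<d> (g \<otimes> p j) (p (t j))"
      using g by (auto intro: W.triangle)
    ultimately show ?thesis
      using t[OF that(1)] t[OF that(2)] W.commute[of "p (t i)" "g \<otimes> p i"]
        W.commute[of "p (t j)" "g \<otimes> p j"] ray_geodesic[of "t i" "t j"] by linarith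
  qed
  have "\<d> (g \<otimes> p i) (p (nat (int i + (int (t I) - int I)))) \<le> shift_error" if i: "I \<le> i" for i
  proof -
    define j where "j = i + nat \<lceil>B + 2 * c\<rceil> + 1"
    have j: "B + 2 * c < real j - real i" "I \<le> j" "i \<le> j" using i unfolding j_def by linarith+
    \<comment> \<open>The index \<open>j\<close> is too far from \<open>l\<close> for \<open>t j\<close> to lie behind \<open>t l\<close>.\<close>
    have fwd: "\<bar>real (t j) - real (t l) - (real j - real l)\<bar> \<le> 2 * c" if "I \<le> l" "l \<le> i" for l
    proof -
      have "real l \<le> real i" using that by simp
      then show ?thesis using tt[OF j(2) that(1)] tB[OF j(2)] tB[OF that(1)] j(1) by linarith
    qed
    have "int i + (int (t I) - int I) \<ge> 0" using i by simp
    then have n: "real (nat (int i + (int (t I) - int I))) = real i + real (t I) - real I" by simp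
    have "\<d> (p (t i)) (p (nat (int i + (int (t I) - int I)))) \<le> 4 * c"
      unfolding ray_geodesic n using fwd[of i] fwd[of I] i by linarith
    then show ?thesis
      using W.triangle[of "g \<otimes> p i" "p (t i)" "p (nat (int i + (int (t I) - int I)))"] t[OF i] g
      by (simp add: shift_error_def c_def)
  qed
  then show ?thesis unfolding shifts_ray_def by blast
qed

text \<open>
  Elements with the same shift send a common far point of the ray into one ball of fixed radius,
  and an element is determined by the image of a point.
\<close>

lemma finite_shift_fibre: "finite {g \<in> carrier G. shifts_ray g s}"
proof -
  define X where "X = {x \<in> carrier G. \<ell> x \<le> shift_error}"
  have "card E \<le> card X" if E: "E \<subseteq> {g \<in> carrier G. shifts_ray g s}" "finite E" for E
  proof -
    have "\<forall>g\<in>E. \<forall>\<^sub>F i in sequentially. \<d> (g \<otimes> p i) (p (nat (int i + s))) \<le> shift_error"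
      using E(1) by (auto simp: shifts_ray_def eventually_sequentially)
    from eventually_ball_finite[OF E(2) this]
    obtain i where i: "\<forall>g\<in>E. \<d> (g \<otimes> p i) (p (nat (int i + s))) \<le> shift_error"
      by (auto simp: eventually_sequentially)
    let ?y = "p (nat (int i + s))"
    have "inj_on (\<lambda>g. inv ?y \<otimes> (g \<otimes> p i)) E"
      using E(1) by (intro inj_onI) (auto simp: subset_iff)
    moreover have "(\<lambda>g. inv ?y \<otimes> (g \<otimes> p i)) ` E \<subseteq> X"
    proof (rule image_subsetI)
      fix g assume "g \<in> E"
      then have "g \<in> carrier G" using E(1) by auto
      then show "inv ?y \<otimes> (g \<otimes> p i) \<in> X"
        using i \<open>g \<in> E\<close> W.commute[of ?y "g \<otimes> p i"] by (simp add: X_def flip: dist_eq)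
    qed
    moreover have "finite X" unfolding X_def by (rule finite_length_le)
    ultimately show ?thesis by (rule card_inj_on_le)
  qed
  then show ?thesis using finite_if_finite_subsets_card_bdd by blast
qed

lemma shift_unique:
  assumes g: "g \<in> carrier G"
    and "\<exists>I. \<forall>i\<ge>I. \<d> (g \<otimes> p i) (p (nat (int i + s))) \<le> A"
    and "\<exists>I. \<forall>i\<ge>I. \<d> (g \<otimes> p i) (p (nat (int i + t))) \<le> B"
  shows "\<bar>real_of_int s - real_of_int t\<bar> \<le> A + B"
proof -
  obtain I J where IJ: "\<forall>i\<ge>I. \<d> (g \<otimes> p i) (p (nat (int i + s))) \<le> A"
    "\<forall>i\<ge>J. \<d> (g \<otimes> p i) (p (nat (int i + t))) \<le> B" using assms by blast
  define i where "i = I + J + nat \<bar>s\<bar> + nat \<bar>t\<bar>"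
  have "I \<le> i" "J \<le> i" "0 \<le> int i + s" "0 \<le> int i + t" by (auto simp: i_def)
  then have "\<d> (p (nat (int i + s))) (p (nat (int i + t))) = \<bar>real_of_int s - real_of_int t\<bar>"
    by (simp add: ray_geodesic)
  then show ?thesis
    using W.triangle[of "p (nat (int i + s))" "g \<otimes> p i" "p (nat (int i + t))"]
      IJ \<open>I \<le> i\<close> \<open>J \<le> i\<close> g W.commute[of "g \<otimes> p i" "p (nat (int i + s))"] by force
qed

text \<open>
  Shifts are additive up to a constant: they form a quasimorphism on the stabilizer of the ray.
\<close>

lemma shift_mult:
  assumes G: "g \<in> carrier G" "h \<in> carrier G"
    and g: "shifts_ray g s" and h: "shifts_ray h t" and gh: "shifts_ray (g \<otimes> h) r"
  shows "\<bar>real_of_int r - (real_of_int s + real_of_int t)\<bar> \<le> 3 * shift_error"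
proof -
  obtain I J where IJ: "\<forall>i\<ge>I. \<d> (g \<otimes> p i) (p (nat (int i + s))) \<le> shift_error"
    "\<forall>i\<ge>J. \<d> (h \<otimes> p i) (p (nat (int i + t))) \<le> shift_error"
    using g h unfolding shifts_ray_def by blast
  have "\<d> (g \<otimes> h \<otimes> p i) (p (nat (int i + (s + t)))) \<le> 2 * shift_error" if i: "I + J + nat \<bar>t\<bar> \<le> i" for i
  proof -
    define j where "j = nat (int i + t)"
    have j: "I \<le> j" "J \<le> i" "int i + (s + t) = int j + s" using i by (auto simp: j_def)
    have "\<d> (g \<otimes> h \<otimes> p i) (g \<otimes> p j) \<le> shift_error"
      using IJ(2) j(2) G by (simp add: m_assoc dist_left_mult j_def)
    moreover have "\<d> (g \<otimes> p j) (p (nat (int i + (s + t)))) \<le> shift_error"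
      using IJ(1) j(1) unfolding j(3) by blast
    ultimately show ?thesis
      using W.triangle[of "g \<otimes> h \<otimes> p i" "g \<otimes> p j" "p (nat (int i + (s + t)))"] G by simp
  qed
  then have "\<bar>real_of_int r - real_of_int (s + t)\<bar> \<le> shift_error + 2 * shift_error"
    using gh G unfolding shifts_ray_def by (intro shift_unique[of "g \<otimes> h"]) blast+
  then show ?thesis by simp
qed

lemma shift_inv:
  assumes "g \<in> carrier G" "shifts_ray g s"
  shows "shifts_ray (inv g) (- s)"
proof -
  obtain I where I: "\<forall>i\<ge>I. \<d> (g \<otimes> p i) (p (nat (int i + s))) \<le> shift_error"
    using assms unfolding shifts_ray_def by blast
  have "\<d> (inv g \<otimes> p i) (p (nat (int i + - s))) \<le> shift_error" if "I + nat \<bar>s\<bar> \<le> i" for i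
  proof -
    define j where "j = nat (int i - s)"
    have j: "I \<le> j" "nat (int j + s) = i" using that by (auto simp: j_def)
    have "\<d> (inv g \<otimes> p i) (p j) = \<d> (p i) (g \<otimes> p j)"
      using dist_left_mult[of g "inv g \<otimes> p i" "p j"] assms(1) by (simp add: cancel_left)
    then show ?thesis using I j W.commute[of "p i"] by (auto simp: j_def)
  qed
  then show ?thesis unfolding shifts_ray_def by blast
qed

text \<open>
  An element with a large positive shift is close, seen from \<open>\<one>\<close>, to the end of the ray.
\<close>

lemma shift_gromov_product:
  assumes g: "g \<in> carrier G" and s: "shifts_ray g s"
  shows "\<exists>I. \<forall>j\<ge>I. real_of_int s - shift_error \<le> W.gp \<one> g (p j)"
proof -
  obtain I where I: "\<forall>i\<ge>I. \<d> (g \<otimes> p i) (p (nat (int i + s))) \<le> shift_error"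
    using s unfolding shifts_ray_def by blast
  have "real_of_int s - shift_error \<le> W.gp \<one> g (p j)" if "I + nat \<bar>s\<bar> \<le> j" for j
  proof -
    define i where "i = nat (int j - s)"
    have i: "I \<le> i" "nat (int i + s) = j" "real i = real j - real_of_int s"
      using that by (auto simp: i_def)
    have "\<d> g (g \<otimes> p i) = real i"
      using dist_left_mult[of g \<one> "p i"] g ray_geodesic[of 0 i] by (simp add: ray_start)
    moreover have "\<d> (g \<otimes> p i) (p j) \<le> shift_error"
      using I[rule_format, OF i(1)] unfolding i(2) .
    moreover have "\<d> g (p j) \<le> \<d> g (g \<otimes> p i) + \<d> (g \<otimes> p i) (p j)"
      using g by (intro W.triangle) auto
    ultimately have "\<d> g (p j) \<le> real j - real_of_int s + shift_error"
      unfolding i(3) by linarith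
    moreover have "real j \<le> \<d> \<one> g + \<d> g (p j)"
      using W.triangle[of \<one> g "p j"] g ray_geodesic[of 0 j] by (simp add: ray_start)
    moreover have "\<d> (p j) \<one> = real j"
      using ray_geodesic[of j 0] by (simp add: ray_start)
    ultimately show ?thesis
      using W.commute[of g \<one>] by (simp add: gromov_product_def)
  qed
  then show ?thesis by blast
qed

text \<open>
  Division with remainder by the shift \<open>s\<close> of \<open>a\<close>: multiplying by \<open>a\<close> or its inverse decreases
  the absolute value of the shift as long as it exceeds \<open>s\<close>. Since shifts have finite fibres, the
  cyclic group generated by \<open>a\<close> has finite index in the stabilizer of the ray.
\<close>

lemma stabilizer_translation:
  assumes a: "a \<in> ray_stabilizer" "shifts_ray a s" and s: "3 * shift_error < real_of_int s"
    and g: "g \<in> ray_stabilizer"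
  shows "\<exists>x\<in>generate G {a}. \<exists>e\<in>{e \<in> carrier G. \<exists>t\<in>{- s..s}. shifts_ray e t}. g = x \<otimes> e"
proof -
  note aG = ray_stabilizer_carrier[OF a(1)]
  note a_gen = generate.incl[of a "{a}" G, simplified] generate.inv[of a "{a}" G, simplified]
  have "0 < s" using s shift_error_pos by simp
  have "\<exists>x\<in>generate G {a}. \<exists>e\<in>{e \<in> carrier G. \<exists>t\<in>{- s..s}. shifts_ray e t}. g = x \<otimes> e"
    if "g \<in> ray_stabilizer" "shifts_ray g r" for g r
    using that
  proof (induction "nat \<bar>r\<bar>" arbitrary: g r rule: less_induct)
    case less
    note gG = ray_stabilizer_carrier[OF less.prems(1)]
    have reduce: ?case if b: "b \<in> ray_stabilizer" "inv b \<in> generate G {a}"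
      and t: "shifts_ray (b \<otimes> g) t" "\<bar>t\<bar> < \<bar>r\<bar>" for b t
    proof -
      have "nat \<bar>t\<bar> < nat \<bar>r\<bar>" using t(2) by simp
      from less.hyps[OF this ray_stabilizer_mult[OF b(1) less.prems(1)] t(1)]
      obtain x e where xe: "x \<in> generate G {a}" "b \<otimes> g = x \<otimes> e"
        "e \<in> {e \<in> carrier G. \<exists>t\<in>{- s..s}. shifts_ray e t}" by blast
      have "x \<in> carrier G" using xe(1) aG generate_in_carrier[of "{a}" x] by simp
      have "g = inv b \<otimes> (b \<otimes> g)"
        using gG ray_stabilizer_carrier[OF b(1)] by (simp add: cancel_left)
      then have "g = (inv b \<otimes> x) \<otimes> e"
        using xe \<open>x \<in> carrier G\<close> ray_stabilizer_carrier[OF b(1)] by (simp add: m_assoc)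
      then show ?thesis using generate.eng[OF b(2) xe(1)] xe(3) by blast
    qed
    show ?case
    proof (cases "\<bar>r\<bar> \<le> s")
      case True
      then have "g \<in> {e \<in> carrier G. \<exists>t\<in>{- s..s}. shifts_ray e t}"
        using gG less.prems(2) by (intro CollectI conjI bexI[of _ r]) auto
      moreover have "g = \<one> \<otimes> g" using gG by simp
      ultimately show ?thesis using generate.one by blast
    next
      case False
      show ?thesis
      proof (cases "0 \<le> r")
        case True
        obtain t where t: "shifts_ray (inv a \<otimes> g) t"
          using stabilizer_shifts_ray ray_stabilizer_mult ray_stabilizer_inv a(1) less.prems(1) by blast
        then have "\<bar>real_of_int t - (real_of_int (- s) + real_of_int r)\<bar> \<le> 3 * shift_error"
          using shift_mult[OF _ gG shift_inv[OF aG a(2)] less.prems(2)] aG by simp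
        then have "\<bar>real_of_int t - real_of_int (r - s)\<bar> < real_of_int s" using s by simp
        then have "\<bar>t - (r - s)\<bar> < s" by linarith
        then have "\<bar>t\<bar> < \<bar>r\<bar>" using True False by linarith
        then show ?thesis
          using reduce[OF ray_stabilizer_inv[OF a(1)] _ t] a_gen(1) aG by simp
      next
        case neg: False
        obtain t where t: "shifts_ray (a \<otimes> g) t"
          using stabilizer_shifts_ray ray_stabilizer_mult a(1) less.prems(1) by blast
        then have "\<bar>real_of_int t - (real_of_int s + real_of_int r)\<bar> \<le> 3 * shift_error"
          using shift_mult[OF aG gG a(2) less.prems(2)] by simp
        then have "\<bar>real_of_int t - real_of_int (r + s)\<bar> < real_of_int s" using s by simp
        then have "\<bar>t - (r + s)\<bar> < s" by linarith
        then have "\<bar>t\<bar> < \<bar>r\<bar>" using neg False by linarith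
        then show ?thesis using reduce[OF a(1) _ t] a_gen(2) by simp
      qed
    qed
  qed
  then show ?thesis using stabilizer_shifts_ray[OF g] g by blast
qed

lemma shift_pow:
  assumes a: "a \<in> ray_stabilizer" "shifts_ray a s" and s: "3 * shift_error + 1 \<le> real_of_int s"
    and "1 \<le> n"
  shows "\<exists>r. shifts_ray (a [^] (n::nat)) r \<and> int n \<le> r"
  using \<open>1 \<le> n\<close>
proof (induction n rule: nat_induct_at_least)
  case base
  have "1 \<le> s" using s shift_error_pos by simp
  then show ?case using a ray_stabilizer_carrier[OF a(1)] by (auto intro: exI[of _ s])
next
  case (Suc n)
  then obtain r where r: "shifts_ray (a [^] n) r" "int n \<le> r" by blast
  note aG = ray_stabilizer_carrier[OF a(1)]
  obtain t where t: "shifts_ray (a [^] Suc n) t"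
    using stabilizer_shifts_ray ray_stabilizer_pow[OF a(1)] by blast
  then have "\<bar>real_of_int t - (real_of_int r + real_of_int s)\<bar> \<le> 3 * shift_error"
    using shift_mult[OF _ aG r(1) a(2)] aG by simp
  then have "real_of_int (int (Suc n)) \<le> real_of_int t" using r(2) s by linarith
  then show ?case using t by auto
qed

text \<open>
  The powers of \<open>a\<close> converge to the end of the ray. The points \<open>g \<otimes> a [^] (m * n)\<close> and
  \<open>a [^] (l * n)\<close> have distance \<open>\<ell> g\<close>, so \<open>g\<close> fixes that limit.
\<close>

lemma intertwining_stabilizes_ray:
  assumes a: "a \<in> ray_stabilizer" "shifts_ray a s" and s: "3 * shift_error + 1 \<le> real_of_int s"
    and g: "g \<in> carrier G" and ml: "1 \<le> m" "1 \<le> l" "g \<otimes> a [^] (m::nat) = a [^] (l::nat) \<otimes> g"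
  shows "g \<in> ray_stabilizer"
proof -
  note aG = ray_stabilizer_carrier[OF a(1)]
  have "\<d> (p j) (g \<otimes> p j) \<le> 3 * \<ell> g + 4 * \<delta>" for j
  proof -
    define n where "n = nat \<lceil>real j + \<ell> g + 2 * \<delta> + shift_error\<rceil> + 1"
    have n: "1 \<le> n" "real j + \<ell> g + 2 * \<delta> \<le> real n - shift_error"
      unfolding n_def by (simp, linarith)
    have *: "\<exists>I. \<forall>J\<ge>I. real j + \<ell> g + 2 * \<delta> \<le> W.gp \<one> (a [^] (q * n)) (p J)" if "1 \<le> q" for q
    proof -
      have "n \<le> q * n" "1 \<le> q * n" using that n(1) by auto
      then obtain r where r: "shifts_ray (a [^] (q * n)) r" "int (q * n) \<le> r"
        using shift_pow[OF a s] by blast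
      have "int n \<le> r" using r(2) \<open>n \<le> q * n\<close> by linarith
      then have "real n \<le> real_of_int r" by linarith
      then show ?thesis using shift_gromov_product[OF _ r(1)] aG n(2) by force
    qed
    obtain I1 I2 where I: "\<forall>J\<ge>I1. real j + \<ell> g + 2 * \<delta> \<le> W.gp \<one> (a [^] (m * n)) (p J)"
      "\<forall>J\<ge>I2. real j + \<ell> g + 2 * \<delta> \<le> W.gp \<one> (a [^] (l * n)) (p J)"
      using *[OF ml(1)] *[OF ml(2)] by blast
    define J where "J = I1 + I2 + j"
    define x y where "x = a [^] (m * n)" and "y = a [^] (l * n)"
    have xy: "x \<in> carrier G" "y \<in> carrier G" using aG by (auto simp: x_def y_def)
    have gx: "real j + \<ell> g + 2 * \<delta> \<le> W.gp \<one> x (p J)" "real j + \<ell> g + 2 * \<delta> \<le> W.gp \<one> y (p J)"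
      using I by (auto simp: J_def x_def y_def)
    have "g \<otimes> x = y \<otimes> g"
      using intertwining_pow[OF g _ _ ml(3), of n] aG by (simp add: x_def y_def nat_pow_pow)
    then have dxy: "\<d> (g \<otimes> x) y = \<ell> g"
      using dist_left_mult[of y g \<one>] xy g dist_one[OF g] W.commute[of g \<one>] by simp
    have 1: "real j + 2 * \<delta> \<le> W.gp \<one> (g \<otimes> p J) (g \<otimes> x)"
      using gx(1) gp_left_mult[of g \<one> "p J" x] W.gp_change_base[of g \<one> "g \<otimes> p J" "g \<otimes> x"]
        g xy W.gp_commute[of \<one> x] dist_one[OF g] W.commute[of g \<one>] by simp
    have "\<d> \<one> y \<le> \<d> \<one> (g \<otimes> x) + \<d> (g \<otimes> x) y" "real j + \<ell> g + 2 * \<delta> \<le> \<d> \<one> y"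
      using W.triangle[of \<one> "g \<otimes> x" y] W.gp_le_dist[of \<one> y "p J"] gx(2) g xy W.commute[of y \<one>] by auto
    then have 2: "real j + 2 * \<delta> \<le> W.gp \<one> (g \<otimes> x) y"
      using dxy W.commute[of _ \<one>] by (simp add: gromov_product_def)
    have "min (W.gp \<one> (g \<otimes> p J) (g \<otimes> x)) (W.gp \<one> (g \<otimes> x) y) - \<delta> \<le> W.gp \<one> (g \<otimes> p J) y"
      "min (W.gp \<one> (g \<otimes> p J) y) (W.gp \<one> y (p J)) - \<delta> \<le> W.gp \<one> (g \<otimes> p J) (p J)"
      using W.four_point g xy by auto
    then have "real j \<le> W.gp \<one> (p J) (g \<otimes> p J)"
      using 1 2 gx(2) W.gp_commute[of \<one> "p J" "g \<otimes> p J"] hyp_delta_nonneg by linarith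
    then show ?thesis
      using ray_geodesic[of 0 j] ray_geodesic[of 0 J] ray_geodesic[of j J] g
      by (intro fellow_travel[of g "p J"]) (auto simp: ray_start J_def)
  qed
  then show ?thesis using g by (auto simp: ray_stabilizer_def)
qed

text \<open>
  An infinite subset of the stabilizer contains an element \<open>x\<close> with large shift. Up to inversion
  \<open>x\<close> is a translation \<open>a\<close> along the ray, and all conjugates of \<open>a\<close> stabilize the ray as well.
  As the powers of \<open>a\<close> have finite index in the stabilizer, every \<open>g\<close> conjugates some power of \<open>a\<close>
  to a power of \<open>a\<close>. If both exponents are positive, \<open>g\<close> stabilizes the ray; the elements that
  invert the direction of \<open>a\<close> form at most one further coset of the stabilizer. So the powers of
  \<open>a\<close> have finite index in the whole group.
\<close>

theorem elementary_if_invariant_set_stabilizes_ray: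
  assumes K: "K \<subseteq> ray_stabilizer" "infinite K"
    and conj: "\<And>g x. g \<in> carrier G \<Longrightarrow> x \<in> K \<Longrightarrow> g \<otimes> x \<otimes> inv g \<in> K"
  shows "elementary G"
proof -
  define s0 where "s0 = \<lceil>3 * shift_error\<rceil> + 1"
  have "finite (\<Union>s\<in>{- s0..s0}. {g \<in> carrier G. shifts_ray g s})"
    using finite_shift_fibre by blast
  then obtain x where x: "x \<in> K" "x \<notin> (\<Union>s\<in>{- s0..s0}. {g \<in> carrier G. shifts_ray g s})"
    using K(2) by (meson finite_subset subsetI)
  then have xF: "x \<in> ray_stabilizer" "x \<in> carrier G" using K(1) ray_stabilizer_carrier by auto
  obtain r where r: "shifts_ray x r" using stabilizer_shifts_ray[OF xF(1)] by blast
  have "r \<notin> {- s0..s0}" using r x(2) xF(2) by auto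
  then have r_large: "s0 < \<bar>r\<bar>" by auto
  define a where "a = (if 0 \<le> r then x else inv x)"
  define s where "s = \<bar>r\<bar>"
  have a: "a \<in> ray_stabilizer" "shifts_ray a s"
    using r xF ray_stabilizer_inv shift_inv by (auto simp: a_def s_def)
  have s: "3 * shift_error + 1 \<le> real_of_int s"
    using r_large unfolding s0_def s_def by linarith
  note aG = ray_stabilizer_carrier[OF a(1)]
  have conj_a: "g \<otimes> a \<otimes> inv g \<in> ray_stabilizer" if g: "g \<in> carrier G" for g
  proof -
    have 1: "g \<otimes> x \<otimes> inv g \<in> ray_stabilizer" using conj[OF g x(1)] K(1) by blast
    have "g \<otimes> inv x \<otimes> inv g = inv (g \<otimes> x \<otimes> inv g)" using g xF(2) by (simp add: group_rules)
    then show ?thesis using 1 ray_stabilizer_inv[OF 1] by (simp add: a_def)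
  qed
  define E where "E = {e \<in> carrier G. \<exists>t\<in>{- s..s}. shifts_ray e t}"
  have "E = (\<Union>t\<in>{- s..s}. {e \<in> carrier G. shifts_ray e t})" by (auto simp: E_def)
  then have "finite E" using finite_shift_fibre by simp
  have cover: "\<exists>x\<in>generate G {a}. \<exists>e\<in>E. g = x \<otimes> e" if "g \<in> ray_stabilizer" for g
    using stabilizer_translation[OF a _ that] s unfolding E_def by simp
  have gen: "subgroup (generate G {a}) G" using aG by (intro generate_is_subgroup) auto
  have inf_order: "a [^] m \<noteq> \<one>" if "1 \<le> m" for m :: nat
  proof
    assume "a [^] m = \<one>"
    define n where "n = nat \<lceil>shift_error\<rceil> + 1"
    have "shift_error < real n" "1 \<le> n" unfolding n_def by linarith+
    moreover have "n \<le> m * n" using mult_le_mono1[OF that, of n] by simp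
    ultimately have n: "shift_error < real n" "1 \<le> m * n" "n \<le> m * n" by linarith+
    obtain r where r: "shifts_ray (a [^] (m * n)) r" "int (m * n) \<le> r"
      using shift_pow[OF a s n(2)] by blast
    have "a [^] (m * n) = \<one>" using \<open>a [^] m = \<one>\<close> aG nat_pow_pow[of a m n] by simp
    then have "shifts_ray \<one> r" using r(1) by simp
    then have "\<bar>real_of_int r - real_of_int 0\<bar> \<le> shift_error + 0"
      unfolding shifts_ray_def by (intro shift_unique[of \<one>]) auto
    moreover have "int n \<le> r" using r(2) n(3) by linarith
    ultimately show False using n(1) by linarith
  qed
  have comm: "\<exists>m::nat. \<exists>l::int. 1 \<le> m \<and> l \<noteq> 0 \<and> g \<otimes> a [^] m = a [^] l \<otimes> g" if g: "g \<in> carrier G" for g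
  proof -
    define b where "b = g \<otimes> a \<otimes> inv g"
    have b: "b \<in> ray_stabilizer" "b \<in> carrier G" using conj_a[OF g] g aG by (auto simp: b_def)
    have "\<forall>i::nat. \<exists>x\<in>generate G {a}. \<exists>e\<in>E. b [^] i = x \<otimes> e"
      using cover ray_stabilizer_pow[OF b(1)] by blast
    then obtain x e where xe: "\<And>i::nat. x i \<in> generate G {a}" "\<And>i. e i \<in> E" "\<And>i. b [^] i = x i \<otimes> e i"
      by metis
    \<comment> \<open>Two powers of \<open>b\<close> lie in the same coset of the group generated by \<open>a\<close>.\<close>
    have "finite (range e)" using xe(2) by (intro finite_subset[OF _ \<open>finite E\<close>]) auto
    then have "\<not> inj e" using finite_imageD[of e UNIV] by auto
    then obtain i j where ij: "i < j" "e i = e j"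
      unfolding inj_def by (metis linorder_neqE_nat)
    have xG: "x i \<in> carrier G" for i using generate_in_carrier[OF _ xe(1)] aG by simp
    have eG: "e i \<in> carrier G" for i using xe(2) by (auto simp: E_def)
    have "b [^] (j - i) = b [^] j \<otimes> inv (b [^] i)"
    proof -
      have "b [^] (j - i) \<otimes> b [^] i = b [^] j" using ij b(2) by (simp add: nat_pow_mult)
      then show ?thesis using b(2) by (metis inv_solve_right nat_pow_closed)
    qed
    also have "\<dots> = x j \<otimes> inv (x i)"
      using xe(3)[of i] xe(3)[of j] ij(2) xG eG by (simp add: group_rules)
    also have "\<dots> \<in> generate G {a}"
      using gen xe(1) by (simp add: subgroup.m_closed subgroup.m_inv_closed)
    finally have "b [^] (j - i) \<in> generate G {a}" .
    then obtain l :: int where l: "b [^] (j - i) = a [^] l"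
      using generate_pow[OF aG] by auto
    have "g \<otimes> a = b \<otimes> g" using g aG by (simp add: b_def group_rules)
    then have eq: "g \<otimes> a [^] (j - i) = a [^] l \<otimes> g"
      using intertwining_pow[OF g aG b(2)] l by simp
    have "l \<noteq> 0"
    proof
      assume "l = 0"
      then have "g \<otimes> a [^] (j - i) = g \<otimes> \<one>" using eq g by simp
      then have "a [^] (j - i) = \<one>" using g aG by (metis cancel_left(1) nat_pow_closed one_closed)
      then show False using inf_order[of "j - i"] ij(1) by simp
    qed
    then show ?thesis using eq ij(1) by (intro exI[of _ "j - i"] exI[of _ l]) auto
  qed
  define inverts where "inverts g \<longleftrightarrow> (\<exists>m l. 1 \<le> m \<and> 1 \<le> l \<and> g \<otimes> a [^] (m::nat) = inv (a [^] (l::nat)) \<otimes> g)" for g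
  have dichotomy: "g \<in> ray_stabilizer \<or> inverts g" if g: "g \<in> carrier G" for g
  proof -
    obtain m :: nat and l :: int where ml: "1 \<le> m" "l \<noteq> 0" "g \<otimes> a [^] m = a [^] l \<otimes> g"
      using comm[OF g] by blast
    show ?thesis
    proof (cases "0 < l")
      case True
      then have l: "a [^] l = a [^] nat l" "1 \<le> nat l" unfolding int_pow_def2 by auto
      show ?thesis
        using intertwining_stabilizes_ray[OF a s g ml(1) l(2)] ml(3) unfolding l(1) by blast
    next
      case False
      then have l: "a [^] l = inv (a [^] nat (- l))" "1 \<le> nat (- l)"
        using ml(2) unfolding int_pow_def2 by auto
      show ?thesis
        using ml(1,3) l(2) unfolding inverts_def l(1) by blast
    qed
  qed
  \<comment> \<open>The quotient of two elements that reverse the direction of \<open>a\<close> preserves it.\<close>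
  have two: "g \<otimes> inv h \<in> ray_stabilizer" if gh: "g \<in> carrier G" "h \<in> carrier G" "inverts g" "inverts h" for g h
  proof -
    obtain m l where ml: "1 \<le> m" "1 \<le> l" "g \<otimes> a [^] (m::nat) = inv (a [^] (l::nat)) \<otimes> g"
      using gh(3) by (auto simp: inverts_def)
    obtain m' l' where ml': "1 \<le> m'" "1 \<le> l'" "h \<otimes> a [^] (m'::nat) = inv (a [^] (l'::nat)) \<otimes> h"
      using gh(4) by (auto simp: inverts_def)
    define A B C where "A = a [^] (m * m')" and "B = a [^] (l * m')" and "C = a [^] (l' * m)"
    have ABC: "A \<in> carrier G" "B \<in> carrier G" "C \<in> carrier G" using aG by (auto simp: A_def B_def C_def)
    have gA: "g \<otimes> A = inv B \<otimes> g"
      using intertwining_pow[OF gh(1) _ _ ml(3), of m'] aG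
      by (simp add: A_def B_def nat_pow_pow flip: nat_pow_inv)
    have hA: "h \<otimes> A = inv C \<otimes> h"
      using intertwining_pow[OF gh(2) _ _ ml'(3), of m] aG
      by (simp add: A_def C_def nat_pow_pow mult.commute flip: nat_pow_inv)
    have "g \<otimes> inv h \<otimes> C = g \<otimes> inv (inv C \<otimes> h)" using gh ABC by (simp add: group_rules)
    also have "\<dots> = g \<otimes> inv A \<otimes> inv h" unfolding hA[symmetric] using gh ABC by (simp add: group_rules)
    also have "g \<otimes> inv A = B \<otimes> g"
    proof -
      have "g = inv B \<otimes> g \<otimes> inv A" unfolding gA[symmetric] using gh ABC by (simp add: group_rules)
      then have "B \<otimes> g = B \<otimes> (inv B \<otimes> g \<otimes> inv A)" by simp
      then show ?thesis using gh ABC by (simp add: group_rules)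
    qed
    finally have "g \<otimes> inv h \<otimes> C = B \<otimes> (g \<otimes> inv h)" using gh ABC by (simp add: m_assoc)
    then show ?thesis
      using ml ml' gh unfolding B_def C_def
      by (intro intertwining_stabilizes_ray[OF a s, of _ "l' * m" "l * m'"]) auto
  qed
  have "finite (rcosets (generate G {a}))"
  proof (cases "\<exists>h\<in>carrier G. inverts h")
    case False
    then show ?thesis
      using dichotomy cover by (intro finite_index[OF gen \<open>finite E\<close>]) (auto simp: E_def)
  next
    case True
    then obtain h where h: "h \<in> carrier G" "inverts h" by blast
    show ?thesis
    proof (rule finite_index[OF gen])
      show "finite (E \<union> (\<lambda>e. e \<otimes> h) ` E)" using \<open>finite E\<close> by simp
      show "E \<union> (\<lambda>e. e \<otimes> h) ` E \<subseteq> carrier G" using h by (auto simp: E_def)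
      fix g assume g: "g \<in> carrier G"
      show "\<exists>y\<in>generate G {a}. \<exists>e\<in>E \<union> (\<lambda>e. e \<otimes> h) ` E. g = y \<otimes> e"
      proof (cases "g \<in> ray_stabilizer")
        case True
        then show ?thesis using cover by blast
      next
        case False
        then have "g \<otimes> inv h \<in> ray_stabilizer" using two[OF g h(1)] dichotomy[OF g] h(2) by blast
        then obtain y e where ye: "y \<in> generate G {a}" "e \<in> E" "g \<otimes> inv h = y \<otimes> e"
          using cover by blast
        have "g = g \<otimes> inv h \<otimes> h" using g h by (simp add: m_assoc)
        also have "\<dots> = y \<otimes> (e \<otimes> h)"
          unfolding ye(3) using generate_in_carrier[OF _ ye(1)] aG ye(2) h by (simp add: m_assoc E_def)
        finally show ?thesis using ye by blast
      qed
    qed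
  qed
  then show ?thesis using aG by (auto simp: elementary_def)
qed

end

section \<open>Counting a conjugacy class from below\<close>

context hyperbolic_group
begin

text \<open>
  Some conjugate \<open>x\<close> of bounded length sends \<open>h\<close> to a direction that is different, as seen from
  \<open>\<one>\<close>, from that of \<open>h\<close>. Otherwise there are elements \<open>h m\<close> whose direction is almost fixed by
  more and more conjugates, and a limit of geodesics from \<open>\<one>\<close> to \<open>h m\<close> is a ray stabilized by
  the whole conjugacy class.
\<close>

theorem conjugate_moves_away:
  assumes ne: "\<not> elementary G" and k: "k \<in> carrier G" and inf: "infinite (conjugacy_class G k)"
  shows "\<exists>C R. \<forall>h\<in>carrier G. \<exists>x\<in>conjugacy_class G k. \<ell> x \<le> R \<and> W.gp \<one> h (x \<otimes> h) \<le> C"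
proof (rule ccontr)
  assume "\<not> ?thesis"
  then have "\<forall>m::nat. \<exists>h\<in>carrier G. \<forall>x\<in>conjugacy_class G k.
      \<ell> x \<le> real m + \<ell> k \<longrightarrow> real m < W.gp \<one> h (x \<otimes> h)"
    by (meson not_le)
  then obtain h where h: "\<And>m. h m \<in> carrier G"
    "\<And>m x. x \<in> conjugacy_class G k \<Longrightarrow> \<ell> x \<le> real m + \<ell> k \<Longrightarrow> real m < W.gp \<one> (h m) (x \<otimes> h m)"
    by metis
  have "real m \<le> \<ell> (h m)" for m
    using h(2)[OF self_in_conjugacy_class[OF k], of m] W.gp_le_dist[of \<one> "h m" "k \<otimes> h m"] h(1) k
      W.commute[of "h m" \<one>] by (simp add: dist_one)
  from geodesic_ray_limit[of h, OF h(1) this]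
  obtain p where p: "p 0 = \<one>" "\<And>i. p i \<in> carrier G" "\<And>i j. \<d> (p i) (p j) = \<bar>real i - real j\<bar>"
    "\<And>i. infinite {m. \<d> \<one> (p i) + \<d> (p i) (h m) = \<d> \<one> (h m)}" by blast
  interpret hyperbolic_group_ray G S \<delta> p
    by unfold_locales (use p in auto)
  have "conjugacy_class G k \<subseteq> ray_stabilizer"
  proof
    fix x assume x: "x \<in> conjugacy_class G k"
    then have xG: "x \<in> carrier G" using conjugacy_class_closed[OF k] by blast
    have "\<d> (p i) (x \<otimes> p i) \<le> 3 * \<ell> x + 4 * \<delta>" for i
    proof -
      obtain m where m: "i + word_norm G S x \<le> m" "\<d> \<one> (p i) + \<d> (p i) (h m) = \<d> \<one> (h m)"
        using p(4)[of i] unfolding infinite_nat_iff_unbounded_le by blast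
      have "\<ell> x \<le> real m + \<ell> k" "real i \<le> real m" using m(1) by simp_all
      then have "\<d> \<one> (p i) \<le> W.gp \<one> (h m) (x \<otimes> h m)"
        using h(2)[OF x, of m] p(3)[of 0 i] p(1) by simp
      then show ?thesis using fellow_travel[OF xG h(1) p(2) m(2)] by simp
    qed
    then show "x \<in> ray_stabilizer" using xG by (auto simp: ray_stabilizer_def)
  qed
  then show False
    using elementary_if_invariant_set_stabilizes_ray[OF _ inf] conjugacy_class_conj[OF k] ne
    by blast
qed

text \<open>
  By \<open>conjugate_moves_away\<close> for \<open>inv g\<close>, every \<open>g\<close> is near a geodesic from \<open>\<one>\<close> to a conjugate
  \<open>f g\<close> of \<open>k\<close> whose length is at most \<open>2 * \<ell> g\<close> up to a constant. Given \<open>f g\<close>, the element \<open>g\<close>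
  is therefore determined up to boundedly many choices by its length; the factor \<open>n + 1\<close> counts
  the lengths.
\<close>

theorem ball_le_conj_count:
  assumes ne: "\<not> elementary G" and k: "k \<in> carrier G" and inf: "infinite (conjugacy_class G k)"
  shows "\<exists>D R. \<forall>n. card (word_ball G S n)
           \<le> (n + 1) * D * conj_count G (conjugacy_class G k) S (2 * n + R)"
proof -
  let ?K = "conjugacy_class G k"
  obtain C R where CR: "\<forall>h\<in>carrier G. \<exists>x\<in>?K. \<ell> x \<le> R \<and> W.gp \<one> h (x \<otimes> h) \<le> C"
    using conjugate_moves_away[OF assms] by blast
  have "\<forall>g\<in>carrier G. \<exists>y\<in>?K. \<ell> y \<le> 2 * \<ell> g + R \<and> W.gp g \<one> y \<le> C"
  proof
    fix g assume g: "g \<in> carrier G"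
    then obtain x where x: "x \<in> ?K" "\<ell> x \<le> R" "W.gp \<one> (inv g) (x \<otimes> inv g) \<le> C"
      using CR by (meson inv_closed)
    have xG: "x \<in> carrier G" using x(1) conjugacy_class_closed[OF k] by blast
    have "\<ell> (g \<otimes> x \<otimes> inv g) \<le> 2 * \<ell> g + R"
      using length_mult_le[of "g \<otimes> x" "inv g"] length_mult_le[of g x] length_inv[OF g] g xG x(2) by simp
    moreover have "W.gp g \<one> (g \<otimes> x \<otimes> inv g) \<le> C"
      using x(3) gp_left_mult[of g \<one> "inv g" "x \<otimes> inv g"] g xG by (simp add: m_assoc)
    ultimately show "\<exists>y\<in>?K. \<ell> y \<le> 2 * \<ell> g + R \<and> W.gp g \<one> y \<le> C"
      using conjugacy_class_conj[OF k g x(1)] by blast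
  qed
  then obtain f where f: "\<And>g. g \<in> carrier G \<Longrightarrow> f g \<in> ?K"
    "\<And>g. g \<in> carrier G \<Longrightarrow> \<ell> (f g) \<le> 2 * \<ell> g + R" "\<And>g. g \<in> carrier G \<Longrightarrow> W.gp g \<one> (f g) \<le> C"
    by metis
  define X where "X = {x \<in> carrier G. \<ell> x \<le> 2 * C + 2 * \<delta>}"
  have "finite X" unfolding X_def by (rule finite_length_le)
  define A where "A = (\<lambda>(r, y). {g \<in> carrier G. word_norm G S g = r \<and> f g = y})"
  have cardA: "card (A ry) \<le> card X" for ry
  proof (cases "A ry = {}")
    case False
    obtain r y where ry: "ry = (r, y)" by fastforce
    obtain g0 where g0: "g0 \<in> A ry" using False by blast
    have A: "g \<in> carrier G" "\<d> \<one> g = real r" "W.gp g \<one> y \<le> C" "y \<in> carrier G" if "g \<in> A ry" for g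
      using that f[of g] conjugacy_class_closed[OF k] by (auto simp: A_def ry dist_one)
    have "inj_on (\<lambda>g. inv g0 \<otimes> g) (A ry)"
      using A(1) g0 by (intro inj_onI) (auto simp: A_def ry)
    moreover have "(\<lambda>g. inv g0 \<otimes> g) ` A ry \<subseteq> X"
    proof (rule image_subsetI)
      fix g assume g: "g \<in> A ry"
      have "real r - C \<le> W.gp \<one> g y" if "g \<in> A ry" for g
        using A[OF that] W.commute[of y] W.commute[of g \<one>] by (simp add: gromov_product_def field_simps)
      from this[OF g] this[OF g0] have "real r - C - \<delta> \<le> W.gp \<one> g0 g"
        using W.four_point[of \<one> g0 y g] A[OF g] A[OF g0] W.gp_commute[of \<one> y g] by simp
      then have "\<d> g0 g \<le> 2 * C + 2 * \<delta>"
        using A[OF g] A[OF g0] W.commute[of _ \<one>] by (simp add: gromov_product_def field_simps)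
      then show "inv g0 \<otimes> g \<in> X" using A(1)[OF g] A(1)[OF g0] by (simp add: X_def dist_eq)
    qed
    ultimately show ?thesis using \<open>finite X\<close> by (rule card_inj_on_le)
  qed simp
  define R' where "R' = nat \<lceil>R\<rceil>"
  have "card (word_ball G S n) \<le> (n + 1) * card X * conj_count G ?K S (2 * n + R')" for n
  proof -
    define I where "I = {..n} \<times> (?K \<inter> word_ball G S (2 * n + R'))"
    have "finite I" unfolding I_def using finite_word_ball[OF generating] by simp
    have "finite (A ry)" for ry
      by (rule finite_subset[OF _ finite_length_le[of "real (fst ry)"]]) (auto simp: A_def)
    have "word_ball G S n \<subseteq> (\<Union>ry\<in>I. A ry)"
    proof
      fix g assume "g \<in> word_ball G S n"
      then have g: "g \<in> carrier G" "word_norm G S g \<le> n" by (auto simp: word_ball_eq)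
      have "R \<le> real R'" unfolding R'_def by linarith
      then have "\<ell> (f g) \<le> real (2 * n + R')" using f(2)[OF g(1)] g(2) by simp
      then have "(word_norm G S g, f g) \<in> I"
        using g f(1)[OF g(1)] conjugacy_class_closed[OF k] by (auto simp: I_def word_ball_eq)
      then show "g \<in> (\<Union>ry\<in>I. A ry)" using g(1) by (force simp: A_def)
    qed
    then have "card (word_ball G S n) \<le> card (\<Union>ry\<in>I. A ry)"
      using \<open>finite I\<close> \<open>\<And>ry. finite (A ry)\<close> by (intro card_mono) auto
    also have "\<dots> \<le> (\<Sum>ry\<in>I. card (A ry))" by (rule card_UN_le[OF \<open>finite I\<close>])
    also have "\<dots> \<le> of_nat (card I) * card X" by (rule sum_bounded_above) (rule cardA)
    also have "card I = (n + 1) * conj_count G ?K S (2 * n + R')"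
      by (simp add: I_def conj_count_def card_cartesian_product)
    finally show ?thesis by (simp add: algebra_simps)
  qed
  then show ?thesis by blast
qed

end

section \<open>Exponential growth rates\<close>

lemma Limsup_filterlim_le:
  fixes f :: "'b \<Rightarrow> 'c :: complete_linorder"
  assumes "filterlim m H F"
  shows "Limsup F (\<lambda>x. f (m x)) \<le> Limsup H f"
proof (rule order_trans[OF Limsup_filtermap_ge[of F f m]])
  show "Limsup (filtermap m F) f \<le> Limsup H f"
    using assms unfolding Limsup_def filterlim_def le_filter_def
    by (intro INF_superset_mono) auto
qed

text \<open>
  Both counting inequalities have this form: a subexponential factor \<open>c\<close> does not contribute to
  the rate, and reparametrising by \<open>m n \<approx> a * n\<close> multiplies the rate by \<open>a\<close>.
\<close>

lemma exp_growth_rate_le: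
  fixes f g c m :: "nat \<Rightarrow> nat"
  assumes le: "\<And>n. f n \<le> c n * g (m n)" and pos: "\<And>n. 0 < c n" "\<And>n. 0 < g (m n)"
    and c: "(\<lambda>n. ln (real (c n)) / real n) \<longlonglongrightarrow> 0"
    and m: "(\<lambda>n. real (m n) / real n) \<longlonglongrightarrow> a" "filterlim m at_top sequentially" and a: "0 < a"
  shows "exp_growth_rate f \<le> ereal a * exp_growth_rate g"
proof -
  define v where "v n = ereal (1 / real n * ln (real (g n)))" for n
  have bound: "1 / real n * ln (real (f n))
      \<le> ln (real (c n)) / real n + real (m n) / real n * (1 / real (m n) * ln (real (g (m n))))"
    if "1 \<le> n" "1 \<le> m n" for n
  proof -
    have "ln (real (f n)) \<le> ln (real (c n * g (m n)))"
    proof (cases "f n = 0")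
      case True
      have "1 \<le> real (c n * g (m n))" using pos[of n] by (simp flip: of_nat_mult)
      then show ?thesis using True by simp
    next
      case False
      then show ?thesis using le[of n] pos by (simp flip: of_nat_mult)
    qed
    also have "\<dots> = ln (real (c n)) + ln (real (g (m n)))"
      using pos[of n] by (simp add: ln_mult)
    finally have "1 / real n * ln (real (f n)) \<le> 1 / real n * (ln (real (c n)) + ln (real (g (m n))))"
      by (intro mult_left_mono) auto
    also have "\<dots> = ln (real (c n)) / real n + real (m n) / real n * (1 / real (m n) * ln (real (g (m n))))"
      using that by (simp add: field_simps)
    finally show ?thesis .
  qed
  have "\<forall>\<^sub>F n in sequentially. 1 \<le> m n" "\<forall>\<^sub>F n::nat in sequentially. 1 \<le> n"
    using m(2) eventually_ge_at_top by (auto simp: filterlim_at_top)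
  then have "\<forall>\<^sub>F n in sequentially. ereal (1 / real n * ln (real (f n)))
      \<le> ereal (ln (real (c n)) / real n) + ereal (real (m n) / real n) * v (m n)"
    by eventually_elim (use bound in \<open>simp add: v_def\<close>)
  then have "exp_growth_rate f
      \<le> limsup (\<lambda>n. ereal (ln (real (c n)) / real n) + ereal (real (m n) / real n) * v (m n))"
    unfolding exp_growth_rate_def by (rule Limsup_mono)
  also have "\<dots> = ereal 0 + limsup (\<lambda>n. ereal (real (m n) / real n) * v (m n))"
    using c by (intro ereal_limsup_lim_add) auto
  also have "\<dots> = ereal a * limsup (\<lambda>n. v (m n))"
    using m(1) a by (subst ereal_limsup_lim_mult[where a = "ereal a"]) auto
  also have "\<dots> \<le> ereal a * limsup v"
    using a by (intro ereal_mult_left_mono Limsup_filterlim_le[OF m(2)]) auto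
  finally show ?thesis unfolding exp_growth_rate_def v_def .
qed

theorem (in hyperbolic_group) growth_rate_conjugacy_class:
  assumes ne: "\<not> elementary G" and k: "k \<in> carrier G" and inf: "infinite (conjugacy_class G k)"
  shows "exp_growth_rate (conj_count G (conjugacy_class G k) S)
       = ereal (1/2) * exp_growth_rate (\<lambda>n. card (word_ball G S n))"
proof (rule antisym)
  have "\<one> \<in> word_ball G S n" for n
    using word_norm_eq_0_iff[OF generating, of \<one>] by (simp add: word_ball_eq)
  then have ball_pos: "0 < card (word_ball G S n)" for n
    using finite_word_ball[OF generating, of n] card_gt_0_iff by blast
  obtain C where C: "\<And>n. conj_count G (conjugacy_class G k) S n \<le> card (word_ball G S (n div 2 + C))"
    using conj_count_le_ball[OF k] by blast
  show "exp_growth_rate (conj_count G (conjugacy_class G k) S)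
      \<le> ereal (1/2) * exp_growth_rate (\<lambda>n. card (word_ball G S n))"
  proof (rule exp_growth_rate_le[where c = "\<lambda>_. 1" and m = "\<lambda>n. n div 2 + C"])
    show "(\<lambda>n. real (n div 2 + C) / real n) \<longlonglongrightarrow> 1/2"
    proof (rule tendsto_sandwich)
      show "\<forall>\<^sub>F n in sequentially. (real n / 2 - 1) / real n \<le> real (n div 2 + C) / real n"
        by (intro always_eventually allI divide_right_mono) linarith+
      show "\<forall>\<^sub>F n in sequentially. real (n div 2 + C) / real n \<le> (real n / 2 + real C) / real n"
        by (intro always_eventually allI divide_right_mono) linarith+
      show "(\<lambda>n. (real n / 2 - 1) / real n) \<longlonglongrightarrow> 1/2" by real_asymp
      show "(\<lambda>n. (real n / 2 + real C) / real n) \<longlonglongrightarrow> 1/2" by real_asymp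
    qed
    show "filterlim (\<lambda>n. n div 2 + C) at_top sequentially"
      unfolding filterlim_at_top eventually_sequentially
    proof (intro allI exI impI)
      fix Z n :: nat assume "2 * Z \<le> n"
      then show "Z \<le> n div 2 + C" by linarith
    qed
  qed (use C ball_pos in auto)
  obtain D R where DR: "\<And>n. card (word_ball G S n)
      \<le> (n + 1) * D * conj_count G (conjugacy_class G k) S (2 * n + R)"
    using ball_le_conj_count[OF assms] by blast
  have pos: "0 < (n + 1) * D * conj_count G (conjugacy_class G k) S (2 * n + R)" for n
    using DR[of n] ball_pos[of n] by linarith
  from pos[of 0] have "0 < D" by auto
  have "exp_growth_rate (\<lambda>n. card (word_ball G S n))
      \<le> ereal 2 * exp_growth_rate (conj_count G (conjugacy_class G k) S)"
  proof (rule exp_growth_rate_le[where c = "\<lambda>n. (n + 1) * D" and m = "\<lambda>n. 2 * n + R"])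
    show "(\<lambda>n. ln (real ((n + 1) * D)) / real n) \<longlonglongrightarrow> 0"
      using \<open>0 < D\<close> by (simp add: ln_mult) real_asymp
    show "(\<lambda>n. real (2 * n + R) / real n) \<longlonglongrightarrow> 2" by simp real_asymp
    show "filterlim (\<lambda>n. 2 * n + R) at_top sequentially"
      unfolding filterlim_at_top eventually_sequentially
    proof (intro allI exI impI)
      fix Z n :: nat assume "Z \<le> n"
      then show "Z \<le> 2 * n + R" by linarith
    qed
  qed (use DR pos in auto)
  then have "ereal (1/2) * exp_growth_rate (\<lambda>n. card (word_ball G S n))
      \<le> ereal (1/2) * (ereal 2 * exp_growth_rate (conj_count G (conjugacy_class G k) S))"
    by (intro ereal_mult_left_mono) auto
  also have "\<dots> = exp_growth_rate (conj_count G (conjugacy_class G k) S)"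
    by (simp flip: mult.assoc)
  finally show "ereal (1/2) * exp_growth_rate (\<lambda>n. card (word_ball G S n))
      \<le> exp_growth_rate (conj_count G (conjugacy_class G k) S)" .
qed

theorem proposition5:
  fixes G :: "('a, 'b) monoid_scheme" and S K :: "'a set" and k :: 'a
  assumes "group G"
    and "word_hyperbolic G"
    and "\<not> elementary G"
    and "finite_generating_set G S"
    and "k \<in> carrier G - virtual_center G S"
    and "K = conjugacy_class G k"
  shows "exp_growth_rate (conj_count G K S)
       = ereal (1/2) * exp_growth_rate (\<lambda>n. card (word_ball G S n))"
proof -
  interpret group G by fact
  have "gromov_hyperbolic (carrier G) (word_dist G S)"
    using word_hyperbolic_generating_set assms(2,4) .
  then obtain \<delta> where \<delta>: "\<delta> \<ge> 0" "\<forall>p\<in>carrier G. \<forall>x\<in>carrier G. \<forall>y\<in>carrier G. \<forall>z\<in>carrier G.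
      gromov_product (word_dist G S) p x z \<ge>
        min (gromov_product (word_dist G S) p x y) (gromov_product (word_dist G S) p y z) - \<delta>"
    by (auto simp: gromov_hyperbolic_def)
  interpret hyperbolic_group G S \<delta>
    by unfold_locales (use assms(4) \<delta> in auto)
  have "infinite (conjugacy_class G k)"
    using finite_conjugacy_class_virtual_center assms(5) by blast
  then show ?thesis
    using growth_rate_conjugacy_class assms(3,5,6) by blast
qed

end
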